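(* Suppose the semidefinite program (P) has an optimal solution $X^*$ such that $\mathrm{rank}(X^* ) < |C_{st}|$ for some $(s,t)\in\mathcal{E}$. Then the solution $(X^*_1,\dots,X^*_\ell)$ of the conversion SDP (C) given by $X^*_s = X^*_{C_sC_s}$, $s=1,\dots,\ell$, is primal degenerate.
   Context: Notation. $\mathbb{S}^n$ is the space of real symmetric $n\times n$ matrices, $A\bullet B=\sum_{i,j}[A]_{ij}[B]_{ij}$ is the trace inner product, $X\succeq 0$ means positive semidefinite, $N=\{1,\dots,n\}$. For $C\subseteq N$, $X_{CC}$ is the principal submatrix of $X$ with rows and columns indexed by $C$. Original SDP (P). Given $A_0,\dots,A_m\in\mathbb{S}^n$ and $b\in\mathbb{R}^m$: $$\min_{X\in\mathbb{S}^n} A_0\bullet X\quad\text{s.t. } A_p\bullet X=b_p\ (p=1,\dots,m),\quad X\succeq 0 .$$ Cliques. The aggregate sparsity pattern is $E=\{(i,j): i\ne j,\ [A_p]_{ij}\neq 0\text{ for some }0\le p\le m\}$. Let $F\supseteq E$ be a chordal extension, i.e. the undirected graph $G(N,F)$ is chordal (every cycle of length greater than 3 has a chord). Let $C_1,\dots,C_\ell$ be all the maximal cliques of $G(N,F)$, and let $\mathcal{T}$ be a clique tree: a tree whose nodes are the maximal cliques, such that for any two cliques their intersection is contained in every clique on the tree path between them. Its edge set is $\mathcal{E}$; each edge is listed once as an ordered pair, and we write $(s,t)\in\mathcal{E}$ for the edge $(C_s,C_t)$. Put $C_{st}=C_s\cap C_t$. Conversion data. For each $s$ let $\sigma_s:C_s\to\{1,\dots,|C_s|\}$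 be a bijection (the ordering of indices in the clique). For $p=0,\dots,m$ let $A_{s,p}\in\mathbb{S}^{|C_s|}$ be defined by $[A_{s,p}]_{\sigma_s(i)\sigma_s(j)}=[A_p]_{ij}$ if $s=\min\{t: i,j\in C_t\}$ and $0$ otherwise ($i,j\in C_s$). For $i,j\in C_s$ let $E_{s,ij}=\tfrac12\big(e_{\sigma_s(i)}e_{\sigma_s(j)}^T+e_{\sigma_s(j)}e_{\sigma_s(i)}^T\big)$, where $e_k$ are the standard basis vectors of $\mathbb{R}^{|C_s|}$. Rows and columns of $X_{C_sC_s}$ are ordered according to $\sigma_s$. Conversion SDP (C): $$\min_{X_s\in\mathbb{S}^{|C_s|}} \sum_{s=1}^\ell A_{s,0}\bullet X_s\quad\text{s.t. } \sum_{s=1}^\ell A_{s,p}\bullet X_s=b_p\ (p=1,\dots,m),$$ $$E_{s,ij}\bullet X_s=E_{t,ij}\bullet X_t\ \ (i\le j,\ i,j\in C_{st},\ (s,t)\in\mathcal{E}),\qquad X_s\succeq 0\ (s=1,\dots,\ell).$$ Nondegeneracy. Let $(X_s)_{s=1}^\ell$ be feasible for (C), $r_s=\mathrm{rank}(X_s)$, with eigenvalue decomposition $X_s=Q_s\,\mathrm{diag}(\lambda_1,\dots,\lambda_{r_s},0,\dots,0)Q_s^T$, $Q_s$ orthogonal. Let $$\mathbb{T}_s=\left\{Q_s\begin{bmatrix} U & V \\ {V^T} & 0 \end{bmatrix}Q_s^T: U\in\mathbb{S}^{r_s},\,V\in\mathbb{R}^{r_s\times(|C_s|-r_s)}\right\},\qquad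 \mathbb{T}_s^\perp=\left\{Q_s\begin{bmatrix}0&0\\0&W\end{bmatrix}Q_s^T: W\in\mathbb{S}^{|C_s|-r_s}\right\},$$ $\mathbb{T}=\mathbb{T}_1\times\cdots\times\mathbb{T}_\ell$, $\mathbb{T}^\perp=\mathbb{T}_1^\perp\times\cdots\times\mathbb{T}_\ell^\perp$. Let $\mathbb{N}$ be the set of $(Y_s)_{s}\in\prod_s\mathbb{S}^{|C_s|}$ with $\sum_s A_{s,p}\bullet Y_s=0$ for all $p=1,\dots,m$ and $E_{s,ij}\bullet Y_s=E_{t,ij}\bullet Y_t$ for all $i\le j$ in $C_{st}$, $(s,t)\in\mathcal{E}$. Its orthogonal complement $\mathbb{N}^\perp$ consists of all tuples whose $s$-th component is $$\sum_{p=1}^m\alpha_pA_{s,p}+\sum_{t:(s,t)\in\mathcal{E}}\ \sum_{i\le j\in C_{st}}\beta_{st,ij}E_{s,ij}-\sum_{t:(t,s)\in\mathcal{E}}\ \sum_{i\le j\in C_{ts}}\beta_{ts,ij}E_{s,ij}$$ for real scalars $\alpha_p,\beta_{st,ij}$ (common to all components). The point $(X_s)$ is primal nondegenerate if the following equivalent conditions hold: $\mathbb{T}+\mathbb{N}=\prod_{s}\mathbb{S}^{|C_s|}$; equivalently $\mathbb{T}^\perp\cap\mathbb{N}^\perp=\{0\}$. It is primal degenerate if it is feasible but not primal nondegenerate. *)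

theory Defs
  imports "HOL-Library.FuncSet" "Jordan_Normal_Form.DL_Rank"
begin

section \<open>Undirected graphs, chordality and clique trees\<close>

text \<open>
  An undirected simple graph on a vertex set \<open>V\<close> is given by its adjacency relation, a symmetric
  irreflexive subset of \<open>V \<times> V\<close>. The notion of tree from the AFP entry \<open>Graph_Theory\<close> is not used,
  because its acyclicity condition refers to directed cycles.
\<close>

definition graph_on :: "'a set \<Rightarrow> 'a rel \<Rightarrow> bool" where
  "graph_on V G \<longleftrightarrow> G \<subseteq> V \<times> V \<and> sym G \<and> irrefl G"

definition path :: "'a set \<Rightarrow> 'a rel \<Rightarrow> 'a list \<Rightarrow> bool" where
  "path V G xs \<longleftrightarrow> xs \<noteq> [] \<and> set xs \<subseteq> V \<and> distinct xs \<and> successively (\<lambda>x y. (x, y) \<in> G) xs"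

definition cycle :: "'a set \<Rightarrow> 'a rel \<Rightarrow> 'a list \<Rightarrow> bool" where
  "cycle V G xs \<longleftrightarrow> path V G xs \<and> length xs \<ge> 3 \<and> (last xs, hd xs) \<in> G"

text \<open>A chord joins two vertices of the cycle that are not consecutive on it (cyclically).\<close>

definition has_chord :: "'a rel \<Rightarrow> 'a list \<Rightarrow> bool" where
  "has_chord G xs \<longleftrightarrow> (\<exists>a b. a < b \<and> b < length xs \<and> b \<noteq> a + 1 \<and> \<not> (a = 0 \<and> b = length xs - 1)
     \<and> (xs ! a, xs ! b) \<in> G)"

definition chordal :: "'a set \<Rightarrow> 'a rel \<Rightarrow> bool" where
  "chordal V G \<longleftrightarrow> graph_on V G \<and> (\<forall>xs. cycle V G xs \<and> length xs > 3 \<longrightarrow> has_chord G xs)"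

definition clique :: "'a set \<Rightarrow> 'a rel \<Rightarrow> 'a set \<Rightarrow> bool" where
  "clique V G K \<longleftrightarrow> K \<subseteq> V \<and> (\<forall>i\<in>K. \<forall>j\<in>K. i \<noteq> j \<longrightarrow> (i, j) \<in> G)"

definition maximal_clique :: "'a set \<Rightarrow> 'a rel \<Rightarrow> 'a set \<Rightarrow> bool" where
  "maximal_clique V G K \<longleftrightarrow> clique V G K \<and> (\<forall>K'. clique V G K' \<and> K \<subseteq> K' \<longrightarrow> K' = K)"

definition tree :: "'a set \<Rightarrow> 'a rel \<Rightarrow> bool" where
  "tree V G \<longleftrightarrow> graph_on V G \<and> V \<noteq> {}
     \<and> (\<forall>u\<in>V. \<forall>v\<in>V. \<exists>xs. path V G xs \<and> hd xs = u \<and> last xs = v)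
     \<and> (\<nexists>xs. cycle V G xs)"

text \<open>
  The tree edges \<open>\<E>\<close> are ordered pairs of clique indices, each undirected edge being listed in
  exactly one of its two orientations.
\<close>

definition clique_tree :: "nat \<Rightarrow> (nat \<Rightarrow> nat set) \<Rightarrow> (nat \<times> nat) set \<Rightarrow> bool" where
  "clique_tree l C \<E> \<longleftrightarrow> \<E> \<inter> \<E>\<inverse> = {} \<and> tree {1..l} (\<E> \<union> \<E>\<inverse>)
     \<and> (\<forall>xs. path {1..l} (\<E> \<union> \<E>\<inverse>) xs \<longrightarrow> (\<forall>u\<in>set xs. C (hd xs) \<inter> C (last xs) \<subseteq> C u))"


section \<open>Symmetric matrices and the original SDP\<close>

text \<open>
  Rows and columns are numbered from 0, so the index set \<open>N\<close> is \<open>{..<n}\<close>. The matrix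
  \<open>A 0\<close> is the objective, \<open>A 1, \<dots>, A m\<close> are the constraints, and the cliques are
  \<open>C 1, \<dots>, C l\<close>.
\<close>

definition sym_mats :: "nat \<Rightarrow> real mat set" where
  "sym_mats k = {X \<in> carrier_mat k k. X\<^sup>T = X}"

definition mat_inner :: "real mat \<Rightarrow> real mat \<Rightarrow> real" where
  "mat_inner A B = (\<Sum>i<dim_row A. \<Sum>j<dim_col A. A $$ (i, j) * B $$ (i, j))"

definition psd :: "nat \<Rightarrow> real mat \<Rightarrow> bool" where
  "psd k X \<longleftrightarrow> X \<in> sym_mats k \<and> (\<forall>v\<in>carrier_vec k. v \<bullet> (X *\<^sub>v v) \<ge> 0)"

definition sdp_feasible :: "nat \<Rightarrow> nat \<Rightarrow> (nat \<Rightarrow> real mat) \<Rightarrow> (nat \<Rightarrow> real) \<Rightarrow> real mat \<Rightarrow> bool" where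
  "sdp_feasible n m A b X \<longleftrightarrow>
     X \<in> sym_mats n \<and> (\<forall>p\<in>{1..m}. mat_inner (A p) X = b p) \<and> psd n X"

definition sdp_optimal :: "nat \<Rightarrow> nat \<Rightarrow> (nat \<Rightarrow> real mat) \<Rightarrow> (nat \<Rightarrow> real) \<Rightarrow> real mat \<Rightarrow> bool" where
  "sdp_optimal n m A b X \<longleftrightarrow> sdp_feasible n m A b X
     \<and> (\<forall>Y. sdp_feasible n m A b Y \<longrightarrow> mat_inner (A 0) X \<le> mat_inner (A 0) Y)"

definition aggregate_sparsity :: "nat \<Rightarrow> nat \<Rightarrow> (nat \<Rightarrow> real mat) \<Rightarrow> (nat \<times> nat) set" where
  "aggregate_sparsity n m A =
     {(i, j). i < n \<and> j < n \<and> i \<noteq> j \<and> (\<exists>p\<le>m. A p $$ (i, j) \<noteq> 0)}"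


section \<open>The conversion SDP\<close>

text \<open>
  Throughout, \<open>\<sigma> s\<close> is a bijection from \<open>C s\<close> to \<open>{..<card (C s)}\<close>, so that \<open>clique_index C \<sigma> s a\<close>
  is the element of \<open>C s\<close> in row \<open>a\<close>.
\<close>

definition clique_index ::
  "(nat \<Rightarrow> nat set) \<Rightarrow> (nat \<Rightarrow> nat \<Rightarrow> nat) \<Rightarrow> nat \<Rightarrow> nat \<Rightarrow> nat" where
  "clique_index C \<sigma> s a = inv_into (C s) (\<sigma> s) a"

definition clique_submatrix ::
  "(nat \<Rightarrow> nat set) \<Rightarrow> (nat \<Rightarrow> nat \<Rightarrow> nat) \<Rightarrow> real mat \<Rightarrow> nat \<Rightarrow> real mat" where
  "clique_submatrix C \<sigma> X s = mat (card (C s)) (card (C s))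
     (\<lambda>(a, b). X $$ (clique_index C \<sigma> s a, clique_index C \<sigma> s b))"

definition clique_data ::
  "nat \<Rightarrow> (nat \<Rightarrow> nat set) \<Rightarrow> (nat \<Rightarrow> nat \<Rightarrow> nat) \<Rightarrow> (nat \<Rightarrow> real mat) \<Rightarrow> nat \<Rightarrow> nat \<Rightarrow> real mat" where
  "clique_data l C \<sigma> A s p = mat (card (C s)) (card (C s))
     (\<lambda>(a, b). let i = clique_index C \<sigma> s a; j = clique_index C \<sigma> s b in
        if s = Min {t \<in> {1..l}. i \<in> C t \<and> j \<in> C t} then A p $$ (i, j) else 0)"

definition outer :: "real vec \<Rightarrow> real vec \<Rightarrow> real mat" where
  "outer u v = mat (dim_vec u) (dim_vec v) (\<lambda>(a, b). u $ a * v $ b)"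

definition entry_mat ::
  "(nat \<Rightarrow> nat set) \<Rightarrow> (nat \<Rightarrow> nat \<Rightarrow> nat) \<Rightarrow> nat \<Rightarrow> nat \<Rightarrow> nat \<Rightarrow> real mat" where
  "entry_mat C \<sigma> s i j =
     (let e = (\<lambda>i. unit_vec (card (C s)) (\<sigma> s i)) in
      (1 / 2) \<cdot>\<^sub>m (outer (e i) (e j) + outer (e j) (e i)))"

text \<open>
  A tuple of blocks is an extensional function on the clique indices \<open>{1..l}\<close>.
\<close>

definition block_space :: "nat \<Rightarrow> (nat \<Rightarrow> nat set) \<Rightarrow> (nat \<Rightarrow> real mat) set" where
  "block_space l C = (\<Pi>\<^sub>E s\<in>{1..l}. sym_mats (card (C s)))"

definition overlap_consistent ::
  "(nat \<Rightarrow> nat set) \<Rightarrow> (nat \<times> nat) set \<Rightarrow> (nat \<Rightarrow> nat \<Rightarrow> nat) \<Rightarrow> (nat \<Rightarrow> real mat) \<Rightarrow> bool" where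
  "overlap_consistent C \<E> \<sigma> X \<longleftrightarrow>
     (\<forall>(s, t)\<in>\<E>. \<forall>i\<in>C s \<inter> C t. \<forall>j\<in>C s \<inter> C t. i \<le> j \<longrightarrow>
        mat_inner (entry_mat C \<sigma> s i j) (X s) = mat_inner (entry_mat C \<sigma> t i j) (X t))"

definition conv_value ::
  "nat \<Rightarrow> (nat \<Rightarrow> nat set) \<Rightarrow> (nat \<Rightarrow> nat \<Rightarrow> nat) \<Rightarrow> (nat \<Rightarrow> real mat) \<Rightarrow> nat \<Rightarrow> (nat \<Rightarrow> real mat) \<Rightarrow> real" where
  "conv_value l C \<sigma> A p X = (\<Sum>s=1..l. mat_inner (clique_data l C \<sigma> A s p) (X s))"

definition conv_feasible ::
  "nat \<Rightarrow> (nat \<Rightarrow> nat set) \<Rightarrow> (nat \<times> nat) set \<Rightarrow> (nat \<Rightarrow> nat \<Rightarrow> nat)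
   \<Rightarrow> nat \<Rightarrow> (nat \<Rightarrow> real mat) \<Rightarrow> (nat \<Rightarrow> real) \<Rightarrow> (nat \<Rightarrow> real mat) \<Rightarrow> bool" where
  "conv_feasible l C \<E> \<sigma> m A b X \<longleftrightarrow> X \<in> block_space l C
     \<and> (\<forall>p\<in>{1..m}. conv_value l C \<sigma> A p X = b p)
     \<and> overlap_consistent C \<E> \<sigma> X
     \<and> (\<forall>s\<in>{1..l}. psd (card (C s)) (X s))"

definition conv_optimal ::
  "nat \<Rightarrow> (nat \<Rightarrow> nat set) \<Rightarrow> (nat \<times> nat) set \<Rightarrow> (nat \<Rightarrow> nat \<Rightarrow> nat)
   \<Rightarrow> nat \<Rightarrow> (nat \<Rightarrow> real mat) \<Rightarrow> (nat \<Rightarrow> real) \<Rightarrow> (nat \<Rightarrow> real mat) \<Rightarrow> bool" where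
  "conv_optimal l C \<E> \<sigma> m A b X \<longleftrightarrow> conv_feasible l C \<E> \<sigma> m A b X
     \<and> (\<forall>Y. conv_feasible l C \<E> \<sigma> m A b Y \<longrightarrow> conv_value l C \<sigma> A 0 X \<le> conv_value l C \<sigma> A 0 Y)"


section \<open>Primal nondegeneracy\<close>

abbreviation mat_rank :: "nat \<Rightarrow> real mat \<Rightarrow> nat" where
  "mat_rank k X \<equiv> vec_space.rank k X"

definition eigen_decomposition :: "nat \<Rightarrow> real mat \<Rightarrow> real mat \<Rightarrow> (nat \<Rightarrow> real) \<Rightarrow> bool" where
  "eigen_decomposition k X Q ev \<longleftrightarrow> Q \<in> carrier_mat k k \<and> Q * Q\<^sup>T = 1\<^sub>m k \<and> Q\<^sup>T * Q = 1\<^sub>m k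
     \<and> X = Q * mat_diag k (\<lambda>i. if i < mat_rank k X then ev i else 0) * Q\<^sup>T"

definition tangent_space :: "nat \<Rightarrow> nat \<Rightarrow> real mat \<Rightarrow> real mat set" where
  "tangent_space k r Q =
     {Q * four_block_mat U V V\<^sup>T (0\<^sub>m (k - r) (k - r)) * Q\<^sup>T | U V.
        U \<in> sym_mats r \<and> V \<in> carrier_mat r (k - r)}"

definition tangent_product ::
  "nat \<Rightarrow> (nat \<Rightarrow> nat set) \<Rightarrow> (nat \<Rightarrow> real mat) \<Rightarrow> (nat \<Rightarrow> real mat) \<Rightarrow> (nat \<Rightarrow> real mat) set" where
  "tangent_product l C X Q =
     (\<Pi>\<^sub>E s\<in>{1..l}. tangent_space (card (C s)) (mat_rank (card (C s)) (X s)) (Q s))"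

definition null_space ::
  "nat \<Rightarrow> (nat \<Rightarrow> nat set) \<Rightarrow> (nat \<times> nat) set \<Rightarrow> (nat \<Rightarrow> nat \<Rightarrow> nat)
   \<Rightarrow> nat \<Rightarrow> (nat \<Rightarrow> real mat) \<Rightarrow> (nat \<Rightarrow> real mat) set" where
  "null_space l C \<E> \<sigma> m A = {Y \<in> block_space l C.
     (\<forall>p\<in>{1..m}. conv_value l C \<sigma> A p Y = 0) \<and> overlap_consistent C \<E> \<sigma> Y}"

text \<open>
  The space \<open>tangent_space k r Q\<close> depends only on the decomposed matrix, not on the choice of its
  decomposition (one always exists for a symmetric matrix). Quantifying existentially over the
  decompositions makes the negation, degeneracy, a statement about all of them.
\<close>

definition primal_nondegenerate ::
  "nat \<Rightarrow> (nat \<Rightarrow> nat set) \<Rightarrow> (nat \<times> nat) set \<Rightarrow> (nat \<Rightarrow> nat \<Rightarrow> nat)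
   \<Rightarrow> nat \<Rightarrow> (nat \<Rightarrow> real mat) \<Rightarrow> (nat \<Rightarrow> real mat) \<Rightarrow> bool" where
  "primal_nondegenerate l C \<E> \<sigma> m A X \<longleftrightarrow>
     (\<exists>Q ev. (\<forall>s\<in>{1..l}. eigen_decomposition (card (C s)) (X s) (Q s) (ev s))
        \<and> {\<lambda>s\<in>{1..l}. Y s + Z s | Y Z. Y \<in> tangent_product l C X Q \<and> Z \<in> null_space l C \<E> \<sigma> m A}
            = block_space l C)"

definition primal_degenerate ::
  "nat \<Rightarrow> (nat \<Rightarrow> nat set) \<Rightarrow> (nat \<times> nat) set \<Rightarrow> (nat \<Rightarrow> nat \<Rightarrow> nat)
   \<Rightarrow> nat \<Rightarrow> (nat \<Rightarrow> real mat) \<Rightarrow> (nat \<Rightarrow> real) \<Rightarrow> (nat \<Rightarrow> real mat) \<Rightarrow> bool" where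
  "primal_degenerate l C \<E> \<sigma> m A b X \<longleftrightarrow>
     conv_feasible l C \<E> \<sigma> m A b X \<and> \<not> primal_nondegenerate l C \<E> \<sigma> m A X"

end

theory Submission
  imports Defs
begin

text \<open>
  Optimality. The submatrices of \<open>X\<close> form a feasible point of the conversion with the same value, so it
  suffices that every feasible tuple of blocks has a positive semidefinite completion. Such a
  completion is grown along the clique tree: a clique \<open>C v\<close> adjacent to \<open>C u\<close> in the part already
  treated meets that part only inside \<open>C u\<close>, where the blocks agree, and two positive semidefinite
  kernels that agree on the overlap of their domains can be glued one vertex at a time.

  Degeneracy. As \<open>rank X < |C\<^sub>s\<^sub>t|\<close>, the columns of \<open>X\<close> indexed by \<open>C\<^sub>s\<^sub>t\<close> are dependent, which gives a
  nonzero \<open>z\<close> supported on \<open>C\<^sub>s\<^sub>t\<close> with \<open>X z = 0\<close>. The nonzero functional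
  \<open>Y \<mapsto> z\<^sup>T Y\<^sub>s z - z\<^sup>T Y\<^sub>t z\<close> vanishes on the null space because the blocks agree on the overlap, and
  on the tangent spaces because \<open>z\<close> lies in the kernels of \<open>X\<^sub>s\<close> and \<open>X\<^sub>t\<close>, so the two spaces do not
  span.
\<close>

section \<open>Positive semidefinite kernels on finite sets\<close>

text \<open>Forms are indexed by sets and evaluated on functions, so that restriction to a subset,
  enlargement by a vertex and gluing need no renumbering. Only values on \<open>I\<close>
  count.\<close>

definition bform :: "'a set \<Rightarrow> ('a \<Rightarrow> 'a \<Rightarrow> real) \<Rightarrow> ('a \<Rightarrow> real) \<Rightarrow> ('a \<Rightarrow> real) \<Rightarrow> real" where
  "bform I W x y = (\<Sum>i\<in>I. \<Sum>j\<in>I. x i * W i j * y j)"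

definition psd_kernel :: "'a set \<Rightarrow> ('a \<Rightarrow> 'a \<Rightarrow> real) \<Rightarrow> bool" where
  "psd_kernel I W \<longleftrightarrow> (\<forall>i\<in>I. \<forall>j\<in>I. W i j = W j i) \<and> (\<forall>x. 0 \<le> bform I W x x)"

lemma psd_kernel_sym: "psd_kernel I W \<Longrightarrow> i \<in> I \<Longrightarrow> j \<in> I \<Longrightarrow> W i j = W j i"
  by (auto simp: psd_kernel_def)

lemma psd_kernel_nonneg: "psd_kernel I W \<Longrightarrow> 0 \<le> bform I W x x"
  by (auto simp: psd_kernel_def)

lemma bform_add_left: "bform I W (\<lambda>i. x i + y i) z = bform I W x z + bform I W y z"
  by (simp add: bform_def algebra_simps sum.distrib)

lemma bform_scale_left: "bform I W (\<lambda>i. c * x i) z = c * bform I W x z"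
  by (simp add: bform_def algebra_simps sum_distrib_left)

lemma bform_diff_left: "bform I W (\<lambda>i. x i - y i) z = bform I W x z - bform I W y z"
  by (simp add: bform_def algebra_simps sum_subtractf)

lemma bform_add_right: "bform I W z (\<lambda>i. x i + y i) = bform I W z x + bform I W z y"
  by (simp add: bform_def algebra_simps sum.distrib)

lemma bform_scale_right: "bform I W z (\<lambda>i. c * x i) = c * bform I W z x"
  by (simp add: bform_def algebra_simps sum_distrib_left)

lemma bform_cong:
  assumes "\<And>i j. i \<in> I \<Longrightarrow> j \<in> I \<Longrightarrow> x i * W i j * y j = x' i * W' i j * y' j"
  shows "bform I W x y = bform I W' x' y'"
  unfolding bform_def by (intro sum.cong refl assms)

lemma bform_commute:
  assumes "psd_kernel I W"
  shows "bform I W x y = bform I W y x"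
proof -
  have "bform I W x y = (\<Sum>j\<in>I. \<Sum>i\<in>I. x i * W i j * y j)"
    unfolding bform_def by (rule sum.swap)
  also have "\<dots> = bform I W y x"
    unfolding bform_def by (intro sum.cong refl) (simp add: psd_kernel_sym[OF assms])
  finally show ?thesis .
qed

lemma bform_mono_support:
  fixes x y :: "'a \<Rightarrow> real"
  assumes "finite I" "J \<subseteq> I" "\<And>i. i \<in> I - J \<Longrightarrow> x i = 0" "\<And>i. i \<in> I - J \<Longrightarrow> y i = 0"
  shows "bform I W x y = bform J W x y"
proof -
  have "bform I W x y = (\<Sum>i\<in>J. \<Sum>j\<in>I. x i * W i j * y j)"
    unfolding bform_def using assms by (intro sum.mono_neutral_right) auto
  also have "\<dots> = bform J W x y"
    unfolding bform_def using assms by (intro sum.cong sum.mono_neutral_right refl) auto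
  finally show ?thesis .
qed

text \<open>Expansion of \<open>y\<close> in the unit vectors of \<open>S\<close>. Its use: a vector
  orthogonal to these unit vectors is orthogonal to everything supported on
  \<open>S\<close>.\<close>

lemma bform_right_support:
  fixes x y :: "'a \<Rightarrow> real"
  assumes "finite I" "S \<subseteq> I" "\<And>i. i \<in> I - S \<Longrightarrow> y i = 0"
  shows "bform I W x y = (\<Sum>s\<in>S. y s * bform I W x (\<lambda>i. of_bool (i = s)))"
proof -
  have e: "bform I W x (\<lambda>i. of_bool (i = s)) = (\<Sum>i\<in>I. x i * W i s)" if "s \<in> I" for s
    using that assms(1) by (auto simp: bform_def of_bool_def if_distrib cong: if_cong)
  have "bform I W x y = (\<Sum>j\<in>I. \<Sum>i\<in>I. x i * W i j * y j)"
    unfolding bform_def by (rule sum.swap)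
  also have "\<dots> = (\<Sum>j\<in>S. \<Sum>i\<in>I. x i * W i j * y j)"
    using assms by (intro sum.mono_neutral_right) auto
  also have "\<dots> = (\<Sum>j\<in>S. y j * bform I W x (\<lambda>i. of_bool (i = j)))"
    using assms(2) by (intro sum.cong refl) (auto simp: e sum_distrib_left mult_ac)
  finally show ?thesis .
qed

lemma psd_kernel_subset:
  assumes "psd_kernel I W" "finite I" "J \<subseteq> I"
  shows "psd_kernel J W"
  unfolding psd_kernel_def
proof (intro conjI allI)
  show "\<forall>i\<in>J. \<forall>j\<in>J. W i j = W j i"
    using psd_kernel_sym[OF assms(1)] assms(3) by blast
  fix x :: "'a \<Rightarrow> real"
  \<comment> \<open>Extension by zero makes the smaller form a value of the larger one.\<close>
  define y where "y = (\<lambda>i. if i \<in> J then x i else 0)"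
  have "0 \<le> bform I W y y" by (rule psd_kernel_nonneg[OF assms(1)])
  also have "\<dots> = bform J W y y"
    using assms by (intro bform_mono_support) (auto simp: y_def)
  also have "\<dots> = bform J W x x" by (intro bform_cong) (simp add: y_def)
  finally show "0 \<le> bform J W x x" .
qed

lemma psd_kernel_cong:
  assumes "\<And>i j. i \<in> I \<Longrightarrow> j \<in> I \<Longrightarrow> W i j = W' i j"
  shows "psd_kernel I W \<longleftrightarrow> psd_kernel I W'"
proof -
  have "bform I W x x = bform I W' x x" for x by (intro bform_cong) (simp add: assms)
  then show ?thesis by (simp add: psd_kernel_def assms cong: ball_cong)
qed

text \<open>The degenerate case of Cauchy-Schwarz: along \<open>t * x + y\<close> the form is affine
  in \<open>t\<close>, and an affine function that is nonnegative on the whole line is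
  constant.\<close>

lemma bform_isotropic:
  assumes "psd_kernel I W" "bform I W x x = 0"
  shows "bform I W x y = 0"
proof (rule ccontr)
  assume n: "bform I W x y \<noteq> 0"
  define b where "b = bform I W x y"
  define c where "c = bform I W y y"
  \<comment> \<open>Chosen to solve \<open>2 * t * b + c = -1\<close>.\<close>
  define t where "t = - (c + 1) / (2 * b)"
  have "0 \<le> bform I W (\<lambda>i. t * x i + y i) (\<lambda>i. t * x i + y i)"
    by (rule psd_kernel_nonneg[OF assms(1)])
  also have "\<dots> = t * bform I W x y + t * bform I W y x + c"
    unfolding bform_add_left bform_add_right bform_scale_left bform_scale_right assms(2) c_def
    by simp
  also have "\<dots> = 2 * t * b + c"
    using bform_commute[OF assms(1), of y x] by (simp add: b_def)
  also have "\<dots> = -1" using n by (simp add: t_def b_def field_simps)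
  finally show False by simp
qed

text \<open>Gram--Schmidt for a possibly degenerate form: an isotropic residual may simply be dropped.\<close>

lemma psd_kernel_projection:
  assumes "psd_kernel I W" "finite I" "S \<subseteq> I"
  shows "\<exists>k. (\<forall>i. i \<notin> S \<longrightarrow> k i = 0)
    \<and> (\<forall>t\<in>S. bform I W (\<lambda>i. x i - k i) (\<lambda>i. of_bool (i = t)) = 0)"
proof -
  have "finite S" using assms finite_subset by blast
  then show ?thesis using assms(3)
  proof (induction S arbitrary: x rule: finite_induct)
    case empty
    then show ?case by auto
  next
    case (insert u S)
    let ?B = "bform I W" and ?e = "\<lambda>t i. of_bool (i = t) :: real"
    \<comment> \<open>The induction hypothesis serves twice: for \<open>x\<close>, and for the unit
      vector at \<open>u\<close>, whose residual \<open>h\<close> is the new orthogonal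
      direction.\<close>
    from insert.IH[of x] insert.prems obtain k where
      k: "\<And>i. i \<notin> S \<Longrightarrow> k i = 0" "\<And>t. t \<in> S \<Longrightarrow> ?B (\<lambda>i. x i - k i) (?e t) = 0" by auto
    from insert.IH[of "?e u"] insert.prems obtain g where
      g: "\<And>i. i \<notin> S \<Longrightarrow> g i = 0" "\<And>t. t \<in> S \<Longrightarrow> ?B (\<lambda>i. ?e u i - g i) (?e t) = 0" by auto
    define h where "h = (\<lambda>i. ?e u i - g i)"
    define f where "f = (\<lambda>i. x i - k i)"
    define c where "c = ?B f h / ?B h h"
    \<comment> \<open>For a vector orthogonal to \<open>S\<close>, pairing with the unit vector at
      \<open>u\<close> and pairing with \<open>h\<close> therefore give the same value.\<close>
    have orth_g: "?B y g = 0" if "\<And>t. t \<in> S \<Longrightarrow> ?B y (?e t) = 0" for y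
      using bform_right_support[of I S g W y] g(1) that assms(2) insert.prems by auto
    have u: "?e u = (\<lambda>i. h i + g i)" by (simp add: h_def)
    have hu: "?B h (?e u) = ?B h h"
      unfolding u bform_add_right using orth_g[of h] g(2) by (simp add: h_def)
    have fu: "?B f (?e u) = ?B f h"
      unfolding u bform_add_right using orth_g[of f] k(2) by (simp add: f_def)
    have fh: "?B f h = 0" if "?B h h = 0"
      using bform_isotropic[OF assms(1) that, of f] bform_commute[OF assms(1)] by metis
    define k' where "k' = (\<lambda>i. k i + c * h i)"
    have res: "(\<lambda>i. x i - k' i) = (\<lambda>i. f i - c * h i)"
      by (simp add: k'_def f_def algebra_simps)
    have "?B (\<lambda>i. x i - k' i) (?e t) = 0" if "t \<in> insert u S" for t
    proof (cases "t = u")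
      case True
      have "?B (\<lambda>i. x i - k' i) (?e t) = ?B f h - c * ?B h h"
        unfolding res bform_diff_left bform_scale_left True fu hu ..
      then show ?thesis using fh by (cases "?B h h = 0") (auto simp: c_def)
    next
      case False
      then have "t \<in> S" using that by auto
      then show ?thesis unfolding res bform_diff_left bform_scale_left
        using k(2)[of t] g(2)[of t] by (simp add: f_def h_def)
    qed
    moreover have "k' i = 0" if "i \<notin> insert u S" for i
      using that k(1) g(1) by (simp add: k'_def h_def)
    ultimately show ?case by blast
  qed
qed

section \<open>Positive semidefinite completion\<close>

text \<open>
  The new row is \<open>j \<mapsto> \<Sum>s. k s * W s j\<close>, where \<open>k\<close> expresses the prescribed row \<open>W' v\<close> on \<open>S\<close> through
  the rows of \<open>W\<close>; the completed form is then a sum of the form of \<open>W\<close> at \<open>x + x v * k\<close> and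
  of \<open>(x v)\<^sup>2\<close> times a Schur complement of \<open>W'\<close>.
\<close>

lemma psd_kernel_extend_vertex:
  assumes W: "psd_kernel J W" and W': "psd_kernel (insert v S) W'"
    and fin: "finite J" and v: "v \<notin> J" and S: "S \<subseteq> J"
    and agree: "\<And>i j. i \<in> S \<Longrightarrow> j \<in> S \<Longrightarrow> W i j = W' i j"
  shows "\<exists>Z. psd_kernel (insert v J) Z \<and> (\<forall>i\<in>J. \<forall>j\<in>J. Z i j = W i j)
    \<and> (\<forall>i\<in>insert v S. \<forall>j\<in>insert v S. Z i j = W' i j)"
proof -
  let ?e = "\<lambda>t i. of_bool (i = t) :: real"
  have finS: "finite S" using S fin finite_subset by blast
  have vS: "v \<notin> S" using v S by auto
  \<comment> \<open>\<open>k\<close> projects the unit vector at \<open>v\<close> onto the vectors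
    supported on \<open>S\<close>, with respect to the form of \<open>W'\<close>.\<close>
  obtain k where k0: "\<And>i. i \<notin> S \<Longrightarrow> k i = 0"
    and k: "\<And>t. t \<in> S \<Longrightarrow> bform (insert v S) W' (\<lambda>i. ?e v i - k i) (?e t) = 0"
    using psd_kernel_projection[OF W' finite.insertI[OF finS] subset_insertI, of "?e v"]
    by (elim exE conjE) metis
  have e: "bform (insert v S) W' x (?e s) = (\<Sum>i\<in>insert v S. x i * W' i s)"
    if "s \<in> insert v S" for s x
    using that finS by (simp add: bform_def of_bool_def if_distrib cong: if_cong)
  \<comment> \<open>Orthogonality of the residual to the unit vector at \<open>t\<close>, written
    out; on \<open>S\<close> the entries of \<open>W'\<close> are those of \<open>W\<close>.\<close>
  have row: "W' v t = (\<Sum>s\<in>S. k s * W s t)" if t: "t \<in> S" for t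
  proof -
    have "0 = (\<Sum>i\<in>insert v S. (?e v i - k i) * W' i t)" using k[OF t] e[of t] t by simp
    also have "\<dots> = W' v t + (\<Sum>i\<in>S. (?e v i - k i) * W' i t)"
      using finS vS k0[OF vS] by simp
    also have "(\<Sum>i\<in>S. (?e v i - k i) * W' i t) = (\<Sum>i\<in>S. - (k i * W i t))"
      using vS t agree by (intro sum.cong refl) auto
    finally show ?thesis by (simp add: sum_negf)
  qed
  define r where "r = (\<lambda>j. \<Sum>s\<in>S. k s * W s j)"
  define Z where "Z = (\<lambda>i j. if i = v then (if j = v then W' v v else r j)
    else if j = v then r i else W i j)"
  have symW: "W i j = W j i" if "i \<in> J" "j \<in> J" for i j
    using psd_kernel_sym[OF W] that by blast
  have rJ: "r j = (\<Sum>s\<in>J. k s * W s j)" for j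
    unfolding r_def using fin S k0 by (intro sum.mono_neutral_left) auto
  have kr: "bform J W k x = (\<Sum>j\<in>J. r j * x j)" for x
  proof -
    have "bform J W k x = (\<Sum>j\<in>J. \<Sum>i\<in>J. k i * W i j * x j)"
      unfolding bform_def by (rule sum.swap)
    then show ?thesis by (simp add: rJ sum_distrib_right)
  qed
  \<comment> \<open>Evaluates the form of \<open>W'\<close> at the residual. By orthogonality only
    its coefficient at \<open>v\<close> survives, which leaves the Schur complement.\<close>
  have schur: "0 \<le> W' v v - bform J W k k"
  proof -
    let ?x = "\<lambda>i. ?e v i - k i"
    have "0 \<le> bform (insert v S) W' ?x ?x" by (rule psd_kernel_nonneg[OF W'])
    also have "\<dots> = (\<Sum>s\<in>insert v S. ?x s * bform (insert v S) W' ?x (?e s))"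
      using finS by (intro bform_right_support) auto
    also have "\<dots> = ?x v * bform (insert v S) W' ?x (?e v)"
      using finS vS k by simp
    also have "\<dots> = (\<Sum>i\<in>insert v S. ?x i * W' i v)"
      using e[of v ?x] k0[OF vS] by simp
    also have "\<dots> = W' v v + (\<Sum>i\<in>S. ?x i * W' i v)"
      using finS vS k0[OF vS] by simp
    also have "(\<Sum>i\<in>S. ?x i * W' i v) = (\<Sum>i\<in>S. - (r i * k i))"
      using vS row psd_kernel_sym[OF W', of _ v] by (intro sum.cong refl) (auto simp: r_def)
    also have "\<dots> = - (\<Sum>i\<in>J. r i * k i)"
      unfolding sum_negf using fin S k0 by (subst sum.mono_neutral_left[of J S]) auto
    finally show ?thesis using kr[of k] by simp
  qed
  have "0 \<le> bform (insert v J) Z x x" for x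
  proof -
    define y where "y = (\<lambda>i. x i + x v * k i)"
    have inner: "(\<Sum>j\<in>insert v J. x i * Z i j * x j) = x i * r i * x v + (\<Sum>j\<in>J. x i * W i j * x j)"
      if "i \<in> J" for i
    proof -
      have "(\<Sum>j\<in>J. x i * Z i j * x j) = (\<Sum>j\<in>J. x i * W i j * x j)"
        using that v by (intro sum.cong refl) (auto simp: Z_def)
      then show ?thesis using fin v that by (auto simp: Z_def)
    qed
    have innerv: "(\<Sum>j\<in>insert v J. x v * Z v j * x j) = x v * W' v v * x v + (\<Sum>j\<in>J. x v * r j * x j)"
    proof -
      have "(\<Sum>j\<in>J. x v * Z v j * x j) = (\<Sum>j\<in>J. x v * r j * x j)"
        using v by (intro sum.cong refl) (auto simp: Z_def)
      then show ?thesis using fin v by (auto simp: Z_def)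
    qed
    have cross: "(\<Sum>j\<in>J. x v * r j * x j) = x v * bform J W k x"
      "(\<Sum>i\<in>J. x i * r i * x v) = x v * bform J W k x"
      unfolding kr sum_distrib_left by (simp_all add: mult_ac)
    have "bform (insert v J) Z x x = (\<Sum>j\<in>insert v J. x v * Z v j * x j)
        + (\<Sum>i\<in>J. \<Sum>j\<in>insert v J. x i * Z i j * x j)"
      unfolding bform_def using fin v by (rule sum.insert)
    also have "\<dots> = x v * W' v v * x v + (\<Sum>j\<in>J. x v * r j * x j)
        + (\<Sum>i\<in>J. x i * r i * x v + (\<Sum>j\<in>J. x i * W i j * x j))"
      unfolding innerv by (intro arg_cong2[where f = "(+)"] refl sum.cong inner)
    also have "\<dots> = x v * W' v v * x v + 2 * x v * bform J W k x + bform J W x x"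
      unfolding sum.distrib cross by (simp add: bform_def[of J W x x])
    also have "\<dots> = (x v)\<^sup>2 * (W' v v - bform J W k k) + bform J W y y"
      unfolding y_def bform_add_left bform_add_right bform_scale_left bform_scale_right
      using bform_commute[OF W, of x k] by (simp add: algebra_simps power2_eq_square)
    finally show ?thesis using schur psd_kernel_nonneg[OF W, of y] by simp
  qed
  moreover have "\<forall>i\<in>insert v J. \<forall>j\<in>insert v J. Z i j = Z j i"
    by (auto simp: Z_def symW)
  ultimately have "psd_kernel (insert v J) Z" unfolding psd_kernel_def by blast
  moreover have "\<forall>i\<in>J. \<forall>j\<in>J. Z i j = W i j" using v by (auto simp: Z_def)
  moreover have "Z i j = W' i j" if "i \<in> insert v S" "j \<in> insert v S" for i j
    using that vS row agree psd_kernel_sym[OF W', of i v]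
    by (auto simp: Z_def r_def)
  ultimately show ?thesis by blast
qed

text \<open>The vertices of \<open>I - J\<close> join \<open>J\<close> one at a time. A new row is
  prescribed only against the part of \<open>I\<close> already present; its entries against
  \<open>J - I\<close> are free and are chosen by the extension lemma.\<close>

lemma psd_kernel_glue:
  assumes W1: "psd_kernel I W1" and W2: "psd_kernel J W2"
    and fin: "finite I" "finite J"
    and agree: "\<And>i j. i \<in> I \<inter> J \<Longrightarrow> j \<in> I \<inter> J \<Longrightarrow> W1 i j = W2 i j"
  shows "\<exists>Z. psd_kernel (I \<union> J) Z \<and> (\<forall>i\<in>I. \<forall>j\<in>I. Z i j = W1 i j)
    \<and> (\<forall>i\<in>J. \<forall>j\<in>J. Z i j = W2 i j)"
proof -
  \<comment> \<open>The set on which \<open>W1\<close> is reproduced becomes all of \<open>I\<close>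
    once \<open>D = I - J\<close>.\<close>
  have "\<exists>Z. psd_kernel (J \<union> D) Z \<and> (\<forall>i\<in>I \<inter> J \<union> D. \<forall>j\<in>I \<inter> J \<union> D. Z i j = W1 i j)
    \<and> (\<forall>i\<in>J. \<forall>j\<in>J. Z i j = W2 i j)" if "finite D" "D \<subseteq> I - J" for D
    using that
  proof (induction D rule: finite_induct)
    case empty
    then show ?case using W2 agree by (intro exI[of _ W2]) auto
  next
    case (insert v D)
    then obtain Z where Z: "psd_kernel (J \<union> D) Z"
      "\<forall>i\<in>I \<inter> J \<union> D. \<forall>j\<in>I \<inter> J \<union> D. Z i j = W1 i j"
      "\<forall>i\<in>J. \<forall>j\<in>J. Z i j = W2 i j" by auto
    have "psd_kernel (insert v (I \<inter> J \<union> D)) W1"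
      using insert.prems by (intro psd_kernel_subset[OF W1 fin(1)]) auto
    moreover have "finite (J \<union> D)" "v \<notin> J \<union> D" "I \<inter> J \<union> D \<subseteq> J \<union> D"
      using insert fin by auto
    moreover have "Z i j = W1 i j" if "i \<in> I \<inter> J \<union> D" "j \<in> I \<inter> J \<union> D" for i j
      using Z(2) that by blast
    ultimately obtain Z' where
      "psd_kernel (insert v (J \<union> D)) Z'" "\<forall>i\<in>J \<union> D. \<forall>j\<in>J \<union> D. Z' i j = Z i j"
      "\<forall>i\<in>insert v (I \<inter> J \<union> D). \<forall>j\<in>insert v (I \<inter> J \<union> D). Z' i j = W1 i j"
      using psd_kernel_extend_vertex[OF Z(1), of v "I \<inter> J \<union> D" W1] by blast
    then show ?case using Z(3) by (intro exI[of _ Z']) auto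
  qed
  from this[of "I - J"] fin show ?thesis by (auto simp: Un_commute Int_Un_distrib)
qed

section \<open>Growing the completion along the clique tree\<close>

text \<open>Applied to a tree path, this yields an edge leaving the set of cliques already
  treated.\<close>

lemma successively_exit:
  assumes "successively P xs" "xs \<noteq> []" "hd xs \<in> T" "last xs \<notin> T"
  shows "\<exists>u v. u \<in> T \<and> v \<notin> T \<and> v \<in> set xs \<and> P u v"
  using assms
proof (induction xs rule: induct_list012)
  case (3 x y zs)
  then show ?case by (cases "y \<in> T") auto
qed auto

lemma path_snoc:
  assumes "path V G xs" "last xs = u" "(u, v) \<in> G" "v \<in> V" "v \<notin> set xs"
  shows "path V G (xs @ [v])"
  using assms by (auto simp: path_def successively_append_iff)

lemma path_Cons:
  assumes "path V G xs" "hd xs = u" "(v, u) \<in> G" "v \<in> V" "v \<notin> set xs"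
  shows "path V G (v # xs)"
  using assms by (auto simp: path_def successively_Cons)

text \<open>The connecting path must stay inside \<open>T\<close>. Appending a vertex from outside
  \<open>T\<close> then repeats no vertex, so the result is again a path, to which the intersection
  property of the clique tree applies.\<close>

definition path_connected_in :: "'a set \<Rightarrow> 'a rel \<Rightarrow> 'a set \<Rightarrow> bool" where
  "path_connected_in V G T \<longleftrightarrow> (\<forall>a\<in>T. \<forall>b\<in>T. \<exists>xs. path V G xs \<and> set xs \<subseteq> T \<and> hd xs = a \<and> last xs = b)"

lemma path_connected_in_insert:
  assumes T: "path_connected_in V G T" and uv: "u \<in> T" "v \<notin> T" "v \<in> V" "(u, v) \<in> G" "sym G"
  shows "path_connected_in V G (insert v T)"
  unfolding path_connected_in_def
proof (intro ballI)
  fix a b assume ab: "a \<in> insert v T" "b \<in> insert v T"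
  have vu: "(v, u) \<in> G" using uv by (meson symD)
  consider "a = v" "b = v" | "a = v" "b \<in> T" | "a \<in> T" "b = v" | "a \<in> T" "b \<in> T"
    using ab by auto
  then show "\<exists>xs. path V G xs \<and> set xs \<subseteq> insert v T \<and> hd xs = a \<and> last xs = b"
  proof cases
    case 1
    then show ?thesis using uv by (intro exI[of _ "[v]"]) (auto simp: path_def)
  next
    case 2
    then obtain xs where xs: "path V G xs" "set xs \<subseteq> T" "hd xs = u" "last xs = b"
      using T uv(1) unfolding path_connected_in_def by blast
    then have "path V G (v # xs)" using path_Cons[OF xs(1,3) vu] uv by auto
    then show ?thesis using 2 xs by (intro exI[of _ "v # xs"]) (auto simp: path_def)
  next
    case 3
    then obtain xs where xs: "path V G xs" "set xs \<subseteq> T" "hd xs = a" "last xs = u"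
      using T uv(1) unfolding path_connected_in_def by blast
    then have "path V G (xs @ [v])" using path_snoc[OF xs(1,4) uv(4)] uv by auto
    then show ?thesis using 3 xs by (intro exI[of _ "xs @ [v]"]) (auto simp: path_def)
  next
    case 4
    then show ?thesis using T unfolding path_connected_in_def by blast
  qed
qed

lemma clique_tree_completion:
  fixes Y :: "nat \<Rightarrow> nat \<Rightarrow> nat \<Rightarrow> real"
  assumes tree: "clique_tree l C \<E>"
    and fin: "\<And>s. s \<in> {1..l} \<Longrightarrow> finite (C s)"
    and psd: "\<And>s. s \<in> {1..l} \<Longrightarrow> psd_kernel (C s) (Y s)"
    and consistent: "\<And>s t i j. (s, t) \<in> \<E> \<Longrightarrow> i \<in> C s \<inter> C t \<Longrightarrow> j \<in> C s \<inter> C t \<Longrightarrow> Y s i j = Y t i j"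
  shows "\<exists>Z. psd_kernel (\<Union>s\<in>{1..l}. C s) Z \<and> (\<forall>s\<in>{1..l}. \<forall>i\<in>C s. \<forall>j\<in>C s. Z i j = Y s i j)"
proof -
  define V where "V = {1..l}"
  define G where "G = \<E> \<union> \<E>\<inverse>"
  have tr: "tree V G" using tree unfolding clique_tree_def V_def G_def by blast
  have rip: "C (hd xs) \<inter> C (last xs) \<subseteq> C u" if "path V G xs" "u \<in> set xs" for xs u
    using tree that unfolding clique_tree_def V_def G_def by blast
  have symG: "sym G" by (auto simp: G_def sym_def)
  have "V \<noteq> {}" and conn: "\<And>u v. u \<in> V \<Longrightarrow> v \<in> V \<Longrightarrow> \<exists>xs. path V G xs \<and> hd xs = u \<and> last xs = v"
    using tr unfolding tree_def by blast+
  \<comment> \<open>Each tree edge is listed in one orientation, but the growth may cross it in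
    either.\<close>
  have consG: "Y s i j = Y t i j" if "(s, t) \<in> G" "i \<in> C s \<inter> C t" "j \<in> C s \<inter> C t" for s t i j
  proof (cases "(s, t) \<in> \<E>")
    case True
    then show ?thesis using consistent that(2,3) by blast
  next
    case False
    then have "Y t i j = Y s i j" using that by (intro consistent) (auto simp: G_def)
    then show ?thesis by simp
  qed
  \<comment> \<open>Connectedness belongs to the invariant because the overlap of a new clique with
    the treated part is controlled through paths inside \<open>T\<close>.\<close>
  define good where "good = (\<lambda>T. T \<subseteq> V \<and> path_connected_in V G T \<and> (\<exists>Z. psd_kernel (\<Union>s\<in>T. C s) Z
    \<and> (\<forall>s\<in>T. \<forall>i\<in>C s. \<forall>j\<in>C s. Z i j = Y s i j)))"
  \<comment> \<open>Each step adds one clique, starting from an arbitrary single one.\<close>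
  have "\<exists>T. good T \<and> card T = k" if "1 \<le> k" "k \<le> card V" for k
    using that
  proof (induction k rule: dec_induct)
    case base
    obtain r where r: "r \<in> V" using \<open>V \<noteq> {}\<close> by auto
    have "path V G [r]" using r by (simp add: path_def)
    then have "path_connected_in V G {r}"
      unfolding path_connected_in_def by (intro ballI exI[of _ "[r]"]) simp
    moreover have "psd_kernel (C r) (Y r)" using r psd by (simp add: V_def)
    ultimately have "good {r}" using r by (auto simp: good_def)
    then show ?case by (intro exI[of _ "{r}"]) simp
  next
    case (step k)
    then obtain T where T: "good T" "card T = k" by auto
    then have TV: "T \<subseteq> V" and Tc: "path_connected_in V G T" by (auto simp: good_def)
    from T obtain Z where Z: "psd_kernel (\<Union>s\<in>T. C s) Z"
      "\<And>s i j. s \<in> T \<Longrightarrow> i \<in> C s \<Longrightarrow> j \<in> C s \<Longrightarrow> Z i j = Y s i j"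
      unfolding good_def by blast
    have "T \<noteq> {}" using T step by auto
    moreover have "T \<noteq> V" using T step by auto
    ultimately obtain a c where "a \<in> T" "c \<in> V" "c \<notin> T" using TV by blast
    moreover obtain xs where "path V G xs" "hd xs = a" "last xs = c"
      using conn[of a c] calculation TV by blast
    ultimately obtain u v where uv: "u \<in> T" "v \<notin> T" "v \<in> V" "(u, v) \<in> G"
      using successively_exit[of "\<lambda>x y. (x, y) \<in> G" xs T] by (auto simp: path_def)
    \<comment> \<open>The path from \<open>t\<close> to \<open>u\<close> inside \<open>T\<close>,
      prolonged by \<open>v\<close>, passes through \<open>u\<close>, so the intersection of its end
      cliques lies in \<open>C u\<close>.\<close>
    have overlap: "C t \<inter> C v \<subseteq> C u" if "t \<in> T" for t
    proof -
      from Tc that uv(1) obtain xs where xs: "path V G xs" "set xs \<subseteq> T" "hd xs = t" "last xs = u"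
        unfolding path_connected_in_def by blast
      have p: "path V G (xs @ [v])" using path_snoc[OF xs(1,4) uv(4,3)] xs(2) uv(2) by auto
      have "xs \<noteq> []" using xs(1) by (simp add: path_def)
      then show ?thesis using rip[OF p, of u] xs by auto
    qed
    \<comment> \<open>By \<open>overlap\<close>, agreement with the whole treated part reduces to
      consistency along the single edge from \<open>u\<close> to \<open>v\<close>.\<close>
    have "Z i j = Y v i j" if "i \<in> (\<Union>s\<in>T. C s) \<inter> C v" "j \<in> (\<Union>s\<in>T. C s) \<inter> C v" for i j
    proof -
      have "i \<in> C u \<inter> C v" "j \<in> C u \<inter> C v" using overlap that by auto
      then show ?thesis using Z(2)[OF uv(1)] consG[OF uv(4)] by auto
    qed
    moreover have "finite (\<Union>s\<in>T. C s)" "finite (C v)" "psd_kernel (C v) (Y v)"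
      using TV fin psd uv(3) finite_subset[OF TV] unfolding V_def by blast+
    ultimately obtain Z' where Z': "psd_kernel ((\<Union>s\<in>T. C s) \<union> C v) Z'"
      "\<forall>i\<in>\<Union>s\<in>T. C s. \<forall>j\<in>\<Union>s\<in>T. C s. Z' i j = Z i j" "\<forall>i\<in>C v. \<forall>j\<in>C v. Z' i j = Y v i j"
      using psd_kernel_glue[OF Z(1), of "C v" "Y v"] by blast
    have "Z' i j = Y s i j" if "s \<in> insert v T" "i \<in> C s" "j \<in> C s" for s i j
    proof (cases "s = v")
      case False
      then have "Z' i j = Z i j" using that Z'(2) by blast
      then show ?thesis using Z(2)[of s i j] that False by simp
    qed (use that Z'(3) in simp)
    moreover have "psd_kernel (\<Union>s\<in>insert v T. C s) Z'" using Z'(1) by (simp add: Un_commute)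
    moreover have "path_connected_in V G (insert v T)" "insert v T \<subseteq> V"
      using path_connected_in_insert[OF Tc uv symG] TV uv(3) by auto
    ultimately have "good (insert v T)"
      unfolding good_def by (intro conjI exI[of _ Z'] ballI) auto
    moreover have "card (insert v T) = Suc k"
      using T(2) uv(2) finite_subset[OF TV] by (simp add: V_def)
    ultimately show ?case by blast
  qed
  from this[of "card V"] obtain T where "good T" "card T = card V"
    using \<open>V \<noteq> {}\<close> by (auto simp: V_def Suc_le_eq card_gt_0_iff)
  moreover have "T = V"
    using calculation card_subset_eq[of V T] unfolding good_def by (simp add: V_def)
  ultimately show ?thesis unfolding good_def V_def by blast
qed


section \<open>Rank\<close>

text \<open>More columns than the rank are dependent. The vector is a function on all indices, zero
  outside \<open>J\<close>, so that it can be restricted to any clique containing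
  \<open>J\<close>.\<close>

lemma low_rank_kernel_vector:
  assumes A: "A \<in> carrier_mat n k" and J: "J \<subseteq> {..<k}" and r: "mat_rank n A < card J"
  obtains z where "\<And>j. j \<notin> J \<Longrightarrow> z j = 0" "\<exists>j\<in>J. z j \<noteq> (0::real)"
    "\<And>i. i < n \<Longrightarrow> (\<Sum>j\<in>J. A $$ (i, j) * z j) = 0"
proof -
  interpret vec_space "TYPE(real)" n .
  have finJ: "finite J" using J finite_subset by blast
  have sub: "col A ` J \<subseteq> set (cols A)" using A J by (auto simp: cols_def)
  have subc: "col A ` J \<subseteq> carrier_vec n" using A by auto
  have "(\<exists>z. (\<forall>j. j \<notin> J \<longrightarrow> z j = 0) \<and> (\<exists>j\<in>J. z j \<noteq> 0) \<and> (\<forall>i<n. (\<Sum>j\<in>J. A $$ (i, j) * z j) = 0))"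
  \<comment> \<open>Linear dependence concerns the set of columns, in which equal columns merge. A
    repeated column is therefore treated apart, by the difference of two unit vectors.\<close>
  proof (cases "inj_on (col A) J")
    case False
    then obtain a b where ab: "a \<in> J" "b \<in> J" "a \<noteq> b" "col A a = col A b"
      by (auto simp: inj_on_def)
    define z where "z = (\<lambda>j. of_bool (j = a) - of_bool (j = b) :: real)"
    have "(\<Sum>j\<in>J. A $$ (i, j) * z j) = 0" if "i < n" for i
    proof -
      have "(\<Sum>j\<in>J. A $$ (i, j) * z j) = A $$ (i, a) - A $$ (i, b)"
        using ab finJ by (simp add: z_def right_diff_distrib sum_subtractf of_bool_def
            if_distrib[of "\<lambda>x. _ * x"] cong: if_cong)
      also have "A $$ (i, a) = col A a $ i" using A J ab(1) that by auto
      also have "A $$ (i, b) = col A b $ i" using A J ab(2) that by auto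
      finally show ?thesis using ab(4) by simp
    qed
    then show ?thesis using ab by (intro exI[of _ z]) (auto simp: z_def)
  next
    case True
    have "lin_dep (col A ` J)"
    proof (rule ccontr)
      assume "\<not> lin_dep (col A ` J)"
      then have "card (col A ` J) \<le> rank A" using rank_ge_card_indpt[OF A sub] by blast
      then show False using r card_image[OF True] by simp
    qed
    then obtain c where c: "lincomb c (col A ` J) = 0\<^sub>v n" "\<exists>v\<in>col A ` J. c v \<noteq> 0"
      using finite_lin_dep[OF _ _ subc] finJ by auto
    \<comment> \<open>The coefficients, pulled back from columns to indices along the injective
      column map.\<close>
    define z where "z = (\<lambda>j. if j \<in> J then c (col A j) else 0)"
    have "(\<Sum>j\<in>J. A $$ (i, j) * z j) = 0" if "i < n" for i
    proof -
      have "0 = lincomb c (col A ` J) $ i" using c that by simp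
      also have "\<dots> = (\<Sum>v\<in>col A ` J. c v * v $ i)" using that subc by (rule lincomb_index)
      also have "\<dots> = (\<Sum>j\<in>J. c (col A j) * col A j $ i)" by (simp add: sum.reindex[OF True])
      also have "\<dots> = (\<Sum>j\<in>J. A $$ (i, j) * z j)"
        using A J that by (intro sum.cong) (auto simp: z_def)
      finally show ?thesis by simp
    qed
    then show ?thesis using c(2) by (intro exI[of _ z]) (auto simp: z_def)
  qed
  then show ?thesis using that by blast
qed

section \<open>Spectral decompositions and tangent spaces\<close>

lemma conjugated_diag_index:
  assumes "Q \<in> carrier_mat k k" "a < k" "b < k"
  shows "(Q * mat_diag k d * Q\<^sup>T) $$ (a, b) = (\<Sum>i<k. Q $$ (a, i) * d i * (Q $$ (b, i) :: real))"
proof -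
  have "Q * mat_diag k d = mat k k (\<lambda>(a, i). Q $$ (a, i) * d i)"
    using assms by (simp add: mat_diag_mult_right)
  then show ?thesis using assms by (simp add: scalar_prod_def atLeast0LessThan)
qed

text \<open>The matrix is a sum of \<open>k\<close> terms of rank at most one, and those with
  \<open>d i = 0\<close> vanish; rank is subadditive.\<close>

lemma rank_conjugated_diag_le:
  assumes Q: "Q \<in> carrier_mat k k"
  shows "mat_rank k (Q * mat_diag k d * Q\<^sup>T) \<le> card {i. i < k \<and> d i \<noteq> (0::real)}"
proof -
  interpret vec_space "TYPE(real)" k .
  \<comment> \<open>The sum of the first \<open>j\<close> rank-one terms.\<close>
  define P where "P = (\<lambda>j. mat k k (\<lambda>(a, b). \<Sum>i<j. Q $$ (a, i) * d i * Q $$ (b, i)))"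
  have "rank (P j) \<le> card {i. i < j \<and> d i \<noteq> 0}" for j
  proof (induction j)
    case 0
    have "P 0 = 0\<^sub>m k k" by (auto simp: P_def)
    then show ?case by (simp add: rank_0I)
  next
    case (Suc j)
    define R where "R = mat k k (\<lambda>(a, b). Q $$ (a, j) * d j * Q $$ (b, j))"
    have PR: "P (Suc j) = P j + R" by (auto simp: P_def R_def)
    show ?case
    proof (cases "d j = 0")
      case True
      have "P (Suc j) = P j" using True by (auto simp: P_def)
      moreover have "{i. i < Suc j \<and> d i \<noteq> 0} = {i. i < j \<and> d i \<noteq> 0}"
        using True by (auto simp: less_Suc_eq)
      ultimately show ?thesis using Suc by simp
    next
      case False
      have "rank R \<le> 1"
        by (rule rank_le_1_product_entries[of _ k "\<lambda>a. Q $$ (a, j) * d j" "\<lambda>b. Q $$ (b, j)"])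
          (auto simp: R_def)
      moreover have "rank (P j + R) \<le> rank (P j) + rank R"
        by (rule rank_subadditive[of _ k]) (auto simp: P_def R_def)
      moreover have "{i. i < Suc j \<and> d i \<noteq> 0} = insert j {i. i < j \<and> d i \<noteq> 0}"
        using False by (auto simp: less_Suc_eq)
      ultimately show ?thesis using Suc PR by simp
    qed
  qed
  moreover have "Q * mat_diag k d * Q\<^sup>T = P k"
    using Q by (intro eq_matI) (auto simp: conjugated_diag_index P_def simp del: index_mult_mat(1))
  ultimately show ?thesis by metis
qed

text \<open>A counting argument: the nonzero diagonal entries number at least the rank and all lie
  among the first \<open>mat_rank k X\<close> positions, so they fill these positions.\<close>

lemma eigen_decomposition_nonzero:
  assumes "eigen_decomposition k X Q ev" "i < mat_rank k X"
  shows "i < k" "ev i \<noteq> 0"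
proof -
  let ?r = "mat_rank k X"
  define d where "d = (\<lambda>i. if i < ?r then ev i else 0)"
  have Q: "Q \<in> carrier_mat k k" and X: "X = Q * mat_diag k d * Q\<^sup>T"
    using assms(1) by (auto simp: eigen_decomposition_def d_def)
  have Xc: "X \<in> carrier_mat k k" using Q by (subst X) auto
  show "i < k" using vec_space.rank_le_nc[OF Xc] assms(2) by simp
  have "?r \<le> card {i. i < k \<and> d i \<noteq> 0}"
    using rank_conjugated_diag_le[OF Q, of d] by (simp flip: X)
  moreover have "{i. i < k \<and> d i \<noteq> 0} \<subseteq> {..<?r}" by (auto simp: d_def)
  ultimately have "{i. i < k \<and> d i \<noteq> 0} = {..<?r}"
    by (intro card_seteq) auto
  then have "i \<in> {i. i < k \<and> d i \<noteq> 0}" using assms(2) by blast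
  then show "ev i \<noteq> 0" using assms(2) by (simp add: d_def)
qed

text \<open>In eigenvector coordinates the first \<open>mat_rank k X\<close> entries of the kernel
  vector vanish, while a tangent matrix is zero on the remaining diagonal block.\<close>

lemma tangent_space_isotropic:
  assumes ed: "eigen_decomposition k X Q ev" and w: "w \<in> carrier_vec k" "X *\<^sub>v w = 0\<^sub>v k"
    and M: "M \<in> tangent_space k (mat_rank k X) Q"
  shows "w \<bullet> (M *\<^sub>v w) = 0"
proof -
  let ?r = "mat_rank k X"
  define d where "d = (\<lambda>i. if i < ?r then ev i else 0)"
  have Q: "Q \<in> carrier_mat k k" and QQ: "Q\<^sup>T * Q = 1\<^sub>m k" and X: "X = Q * mat_diag k d * Q\<^sup>T"
    using ed by (auto simp: eigen_decomposition_def d_def)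
  have Xc: "X \<in> carrier_mat k k" using Q by (subst X) auto
  have rk: "?r \<le> k" by (rule vec_space.rank_le_nc[OF Xc])
  define u where "u = Q\<^sup>T *\<^sub>v w"
  have u: "u \<in> carrier_vec k" using Q w by (auto simp: u_def)
  have D: "mat_diag k d \<in> carrier_mat k k" by simp
  note Du = mult_mat_vec_carrier[OF D u]
  have "X *\<^sub>v w = (Q * mat_diag k d) *\<^sub>v u"
    unfolding u_def using Q w mult_carrier_mat[OF Q D]
    by (subst X) (rule assoc_mult_mat_vec[of _ k k _ k], auto)
  also have "\<dots> = Q *\<^sub>v (mat_diag k d *\<^sub>v u)"
    by (rule assoc_mult_mat_vec[OF Q D u])
  finally have Xw: "X *\<^sub>v w = Q *\<^sub>v (mat_diag k d *\<^sub>v u)" .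
  \<comment> \<open>Orthogonality of \<open>Q\<close> transfers the kernel condition from
    \<open>X\<close> to the diagonal matrix.\<close>
  have "mat_diag k d *\<^sub>v u = (Q\<^sup>T * Q) *\<^sub>v (mat_diag k d *\<^sub>v u)"
    unfolding QQ by (rule one_mult_mat_vec[symmetric, OF Du])
  also have "\<dots> = Q\<^sup>T *\<^sub>v (X *\<^sub>v w)"
    unfolding Xw using Q Du by (intro assoc_mult_mat_vec) auto
  also have "\<dots> = 0\<^sub>v k" using w Q by auto
  finally have du: "mat_diag k d *\<^sub>v u = 0\<^sub>v k" .
  have u0: "u $ i = 0" if "i < ?r" for i
  proof -
    note nz = eigen_decomposition_nonzero[OF ed that]
    have "0 = (mat_diag k d *\<^sub>v u) $ i" using du nz by simp
    also have "\<dots> = (\<Sum>j<k. (if i = j then d j else 0) * u $ j)"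
      using nz u by (simp add: scalar_prod_def mat_diag_def atLeast0LessThan)
    also have "\<dots> = ev i * u $ i" using nz that by (simp add: d_def if_distrib if_distribR cong: if_cong)
    finally show ?thesis using nz by simp
  qed
  from M obtain U V where U: "U \<in> sym_mats ?r" and V: "V \<in> carrier_mat ?r (k - ?r)"
    and Meq: "M = Q * four_block_mat U V V\<^sup>T (0\<^sub>m (k - ?r) (k - ?r)) * Q\<^sup>T"
    by (auto simp: tangent_space_def)
  define B where "B = four_block_mat U V V\<^sup>T (0\<^sub>m (k - ?r) (k - ?r))"
  have Uc: "U \<in> carrier_mat ?r ?r" using U by (simp add: sym_mats_def)
  have Bc: "B \<in> carrier_mat k k" using Uc V rk by (auto simp: B_def)
  have B0: "B $$ (a, b) = 0" if "a < k" "b < k" "\<not> a < ?r" "\<not> b < ?r" for a b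
    using that Uc V rk by (auto simp: B_def)
  have "w \<bullet> (M *\<^sub>v w) = w \<bullet> (Q *\<^sub>v (B *\<^sub>v u))"
    using Q Bc w by (simp add: Meq B_def[symmetric] u_def assoc_mult_mat_vec[of _ k k _ k])
  also have "\<dots> = u \<bullet> (B *\<^sub>v u)"
    using Q Bc w u by (simp add: u_def transpose_vec_mult_scalar[of Q k k, symmetric])
  also have "\<dots> = (\<Sum>a<k. \<Sum>b<k. u $ a * (B $$ (a, b) * u $ b))"
    using Bc u by (simp add: scalar_prod_def sum_distrib_left atLeast0LessThan)
  also have "\<dots> = 0"
  proof (intro sum.neutral ballI)
    \<comment> \<open>Each product has a zero factor: a coordinate of \<open>u\<close> if some index
      is below the rank, and the entry of \<open>B\<close> otherwise.\<close>
    fix a b assume "a \<in> {..<k}" "b \<in> {..<k}"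
    then show "u $ a * (B $$ (a, b) * u $ b) = 0"
      using u0[of a] u0[of b] B0[of a b] by (cases "a < ?r"; cases "b < ?r") auto
  qed
  finally show ?thesis .
qed

section \<open>The conversion\<close>

lemma bform_reindex:
  assumes f: "bij_betw f I {..<k}" and X: "X \<in> carrier_mat k k" and v: "v \<in> carrier_vec k"
  shows "bform I (\<lambda>i j. X $$ (f i, f j)) (\<lambda>i. v $ f i) (\<lambda>i. v $ f i) = v \<bullet> (X *\<^sub>v v)"
proof -
  have "bform I (\<lambda>i j. X $$ (f i, f j)) (\<lambda>i. v $ f i) (\<lambda>i. v $ f i)
      = (\<Sum>i\<in>I. \<Sum>b<k. v $ f i * X $$ (f i, b) * v $ b)"
    unfolding bform_def
    by (intro sum.cong refl) (rule sum.reindex_bij_betw[OF f, of "\<lambda>b. v $ f _ * X $$ (f _, b) * v $ b"])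
  also have "\<dots> = (\<Sum>a<k. \<Sum>b<k. v $ a * X $$ (a, b) * v $ b)"
    by (rule sum.reindex_bij_betw[OF f, of "\<lambda>a. \<Sum>b<k. v $ a * X $$ (a, b) * v $ b"])
  also have "\<dots> = v \<bullet> (X *\<^sub>v v)"
    using X v by (simp add: scalar_prod_def sum_distrib_left atLeast0LessThan mult.assoc)
  finally show ?thesis .
qed

lemma sym_mats_iff:
  "X \<in> sym_mats k \<longleftrightarrow> X \<in> carrier_mat k k \<and> (\<forall>a<k. \<forall>b<k. X $$ (a, b) = X $$ (b, a))"
proof -
  have "X\<^sup>T = X" if "X \<in> carrier_mat k k" "\<forall>a<k. \<forall>b<k. X $$ (a, b) = X $$ (b, a)"
    using that by (intro eq_matI) auto
  moreover have "X $$ (a, b) = X $$ (b, a)" if "X \<in> carrier_mat k k" "X\<^sup>T = X" "a < k" "b < k" for a b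
    using that index_transpose_mat(1)[of b X a] by auto
  ultimately show ?thesis unfolding sym_mats_def by blast
qed

text \<open>The bridge between ordered blocks and kernels on cliques; vectors and functions on
  \<open>I\<close> correspond through \<open>f\<close>.\<close>

lemma psd_iff_kernel:
  assumes f: "bij_betw f I {..<k}" and X: "X \<in> carrier_mat k k"
  shows "psd k X \<longleftrightarrow> psd_kernel I (\<lambda>i j. X $$ (f i, f j))"
proof -
  have img: "f ` I = {..<k}" using f by (simp add: bij_betw_def)
  have "X \<in> sym_mats k \<longleftrightarrow> (\<forall>a\<in>f ` I. \<forall>b\<in>f ` I. X $$ (a, b) = X $$ (b, a))"
    unfolding sym_mats_iff img using X by blast
  then have sym: "X \<in> sym_mats k \<longleftrightarrow> (\<forall>i\<in>I. \<forall>j\<in>I. X $$ (f i, f j) = X $$ (f j, f i))"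
    by blast
  have "0 \<le> bform I (\<lambda>i j. X $$ (f i, f j)) x x"
    if "\<forall>v\<in>carrier_vec k. v \<bullet> (X *\<^sub>v v) \<ge> 0" for x
  proof -
    define v where "v = vec k (\<lambda>a. x (inv_into I f a))"
    have vx: "v $ f i = x i" if "i \<in> I" for i
    proof -
      have "f i < k" using that img by blast
      then show ?thesis using that f by (simp add: v_def bij_betw_def)
    qed
    have "bform I (\<lambda>i j. X $$ (f i, f j)) x x
        = bform I (\<lambda>i j. X $$ (f i, f j)) (\<lambda>i. v $ f i) (\<lambda>i. v $ f i)"
      by (intro bform_cong) (simp add: vx)
    also have "\<dots> = v \<bullet> (X *\<^sub>v v)" by (rule bform_reindex[OF f X]) (simp add: v_def)
    finally show ?thesis using that by (simp add: v_def)
  qed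
  moreover have "v \<bullet> (X *\<^sub>v v) \<ge> 0"
    if "\<forall>x. 0 \<le> bform I (\<lambda>i j. X $$ (f i, f j)) x x" "v \<in> carrier_vec k" for v
    using that(1) bform_reindex[OF f X that(2)] by metis
  ultimately show ?thesis unfolding psd_def psd_kernel_def sym by blast
qed

text \<open>The symmetrized unit matrix averages two mirror entries, which coincide in a symmetric
  matrix.\<close>

lemma mat_inner_entry_mat:
  assumes Y: "Y \<in> sym_mats (card (C s))" and i: "\<sigma> s i < card (C s)" and j: "\<sigma> s j < card (C s)"
  shows "mat_inner (entry_mat C \<sigma> s i j) Y = Y $$ (\<sigma> s i, \<sigma> s j)"
proof -
  let ?k = "card (C s)"
  have d: "dim_row (entry_mat C \<sigma> s i j) = ?k" "dim_col (entry_mat C \<sigma> s i j) = ?k"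
    by (simp_all add: entry_mat_def outer_def)
  \<comment> \<open>Keeping the two halves apart also covers \<open>i = j\<close>, where both hit
    the same diagonal entry.\<close>
  have "mat_inner (entry_mat C \<sigma> s i j) Y =
    (\<Sum>a<?k. \<Sum>b<?k. (if a = \<sigma> s i then (if b = \<sigma> s j then Y $$ (a, b) / 2 else 0) else 0)
      + (if a = \<sigma> s j then (if b = \<sigma> s i then Y $$ (a, b) / 2 else 0) else 0))"
    unfolding mat_inner_def d
    using i j by (intro sum.cong refl) (auto simp: entry_mat_def outer_def)
  also have "\<dots> = Y $$ (\<sigma> s i, \<sigma> s j) / 2 + Y $$ (\<sigma> s j, \<sigma> s i) / 2"
    unfolding sum.distrib
  proof (intro arg_cong2[where f = "(+)"])
    have "(\<Sum>a<?k. \<Sum>b<?k. if a = c then (if b = d then Y $$ (a, b) / 2 else 0) else 0) = Y $$ (c, d) / 2"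
      if "c < ?k" "d < ?k" for c d
    proof -
      have "(\<Sum>a<?k. \<Sum>b<?k. if a = c then (if b = d then Y $$ (a, b) / 2 else 0) else 0)
          = (\<Sum>a<?k. if a = c then Y $$ (a, d) / 2 else 0)"
        using that by (intro sum.cong refl) simp
      then show ?thesis using that by simp
    qed
    from this[OF i j] this[OF j i] show
      "(\<Sum>a<?k. \<Sum>b<?k. if a = \<sigma> s i then (if b = \<sigma> s j then Y $$ (a, b) / 2 else 0) else 0)
        = Y $$ (\<sigma> s i, \<sigma> s j) / 2"
      "(\<Sum>a<?k. \<Sum>b<?k. if a = \<sigma> s j then (if b = \<sigma> s i then Y $$ (a, b) / 2 else 0) else 0)
        = Y $$ (\<sigma> s j, \<sigma> s i) / 2" .
  qed
  also have "Y $$ (\<sigma> s j, \<sigma> s i) = Y $$ (\<sigma> s i, \<sigma> s j)"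
    using Y i j by (simp add: sym_mats_iff)
  finally show ?thesis by simp
qed

lemma mat_inner_clique_data:
  assumes \<sigma>: "bij_betw (\<sigma> s) (C s) {..<card (C s)}"
  shows "mat_inner (clique_data l C \<sigma> A s p) Y = (\<Sum>i\<in>C s. \<Sum>j\<in>C s.
    (if s = Min {t \<in> {1..l}. i \<in> C t \<and> j \<in> C t} then A p $$ (i, j) else 0) * Y $$ (\<sigma> s i, \<sigma> s j))"
proof -
  let ?k = "card (C s)"
  define f where "f = (\<lambda>a b. clique_data l C \<sigma> A s p $$ (a, b) * Y $$ (a, b))"
  have idx: "clique_index C \<sigma> s (\<sigma> s i) = i" "\<sigma> s i < ?k" if "i \<in> C s" for i
    using \<sigma> that by (auto simp: clique_index_def bij_betw_def)
  have "mat_inner (clique_data l C \<sigma> A s p) Y = (\<Sum>a<?k. \<Sum>b<?k. f a b)"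
    by (simp add: mat_inner_def f_def clique_data_def)
  also have "\<dots> = (\<Sum>i\<in>C s. \<Sum>b<?k. f (\<sigma> s i) b)"
    by (rule sum.reindex_bij_betw[OF \<sigma>, symmetric])
  also have "\<dots> = (\<Sum>i\<in>C s. \<Sum>j\<in>C s. f (\<sigma> s i) (\<sigma> s j))"
    by (simp only: sum.reindex_bij_betw[OF \<sigma>])
  also have "\<dots> = (\<Sum>i\<in>C s. \<Sum>j\<in>C s.
    (if s = Min {t \<in> {1..l}. i \<in> C t \<and> j \<in> C t} then A p $$ (i, j) else 0) * Y $$ (\<sigma> s i, \<sigma> s j))"
    by (intro sum.cong refl) (simp add: f_def clique_data_def idx)
  finally show ?thesis .
qed

lemma clique_in_maximal_clique:
  assumes "finite V" "clique V G K"
  obtains M where "maximal_clique V G M" "K \<subseteq> M"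
proof -
  let ?S = "{K'. clique V G K' \<and> K \<subseteq> K'}"
  have "?S \<subseteq> Pow V" by (auto simp: clique_def)
  then have "finite ?S" using assms(1) finite_subset by blast
  from finite_has_maximal[OF this] assms(2) obtain M where
    "M \<in> ?S" "\<forall>K'\<in>?S. M \<subseteq> K' \<longrightarrow> M = K'" by blast
  then show ?thesis by (intro that[of M]) (auto simp: maximal_clique_def)
qed

text \<open>Collects what the graph hypotheses supply: the cliques contain every index pair with
  nonzero data and exhaust the index set. In the theorem both follow by enlarging small cliques to
  maximal ones.\<close>

locale conversion =
  fixes n m l :: nat
    and A :: "nat \<Rightarrow> real mat"
    and C :: "nat \<Rightarrow> nat set" and \<E> :: "(nat \<times> nat) set"
    and \<sigma> :: "nat \<Rightarrow> nat \<Rightarrow> nat"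
  assumes data: "p \<le> m \<Longrightarrow> A p \<in> carrier_mat n n"
    and cover: "p \<le> m \<Longrightarrow> i < n \<Longrightarrow> j < n \<Longrightarrow> A p $$ (i, j) \<noteq> 0 \<Longrightarrow> \<exists>s\<in>{1..l}. i \<in> C s \<and> j \<in> C s"
    and union: "(\<Union>s\<in>{1..l}. C s) = {..<n}"
    and clique_tree: "clique_tree l C \<E>"
    and ordering: "s \<in> {1..l} \<Longrightarrow> bij_betw (\<sigma> s) (C s) {..<card (C s)}"
begin

lemma clique_subset: "s \<in> {1..l} \<Longrightarrow> C s \<subseteq> {..<n}"
  using union by blast

lemma finite_clique: "s \<in> {1..l} \<Longrightarrow> finite (C s)"
  using clique_subset finite_subset by blast

lemma \<sigma>_less: "s \<in> {1..l} \<Longrightarrow> i \<in> C s \<Longrightarrow> \<sigma> s i < card (C s)"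
  using ordering[of s] by (auto simp: bij_betw_def)

lemma edge_nodes: "(s, t) \<in> \<E> \<Longrightarrow> s \<in> {1..l} \<and> t \<in> {1..l} \<and> s \<noteq> t"
  using clique_tree unfolding clique_tree_def tree_def graph_on_def irrefl_def by blast

lemma block_sym: "Y \<in> block_space l C \<Longrightarrow> s \<in> {1..l} \<Longrightarrow> Y s \<in> sym_mats (card (C s))"
  unfolding block_space_def by (rule PiE_mem)

text \<open>Symmetry of the blocks turns the constraints for \<open>i \<le> j\<close> into equality
  of all entries on the overlap.\<close>

lemma overlap_consistent_iff:
  assumes "Y \<in> block_space l C"
  shows "overlap_consistent C \<E> \<sigma> Y \<longleftrightarrow> (\<forall>(s, t)\<in>\<E>. \<forall>i\<in>C s \<inter> C t. \<forall>j\<in>C s \<inter> C t.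
    Y s $$ (\<sigma> s i, \<sigma> s j) = Y t $$ (\<sigma> t i, \<sigma> t j))"
proof -
  have entry: "mat_inner (entry_mat C \<sigma> s i j) (Y s) = Y s $$ (\<sigma> s i, \<sigma> s j)"
    if "s \<in> {1..l}" "i \<in> C s" "j \<in> C s" for s i j
    using that by (intro mat_inner_entry_mat block_sym[OF assms] \<sigma>_less)
  have sym: "Y s $$ (\<sigma> s i, \<sigma> s j) = Y s $$ (\<sigma> s j, \<sigma> s i)"
    if "s \<in> {1..l}" "i \<in> C s" "j \<in> C s" for s i j
    using block_sym[OF assms that(1)] \<sigma>_less[OF that(1)] that by (simp add: sym_mats_iff)
  have "(\<forall>i\<in>C s \<inter> C t. \<forall>j\<in>C s \<inter> C t. i \<le> j \<longrightarrow>
        mat_inner (entry_mat C \<sigma> s i j) (Y s) = mat_inner (entry_mat C \<sigma> t i j) (Y t))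
      \<longleftrightarrow> (\<forall>i\<in>C s \<inter> C t. \<forall>j\<in>C s \<inter> C t. Y s $$ (\<sigma> s i, \<sigma> s j) = Y t $$ (\<sigma> t i, \<sigma> t j))"
    (is "?L \<longleftrightarrow> ?R") if e: "(s, t) \<in> \<E>" for s t
  proof
    assume L: ?L
    show ?R
    proof (intro ballI)
      fix i j assume ij: "i \<in> C s \<inter> C t" "j \<in> C s \<inter> C t"
      have *: "Y s $$ (\<sigma> s i, \<sigma> s j) = Y t $$ (\<sigma> t i, \<sigma> t j)"
        if "i \<le> j" "i \<in> C s \<inter> C t" "j \<in> C s \<inter> C t" for i j
        using L that entry edge_nodes[OF e] by auto
      show "Y s $$ (\<sigma> s i, \<sigma> s j) = Y t $$ (\<sigma> t i, \<sigma> t j)"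
      proof (cases "i \<le> j")
        case False
        then have "Y s $$ (\<sigma> s j, \<sigma> s i) = Y t $$ (\<sigma> t j, \<sigma> t i)" using * ij by simp
        then show ?thesis using sym[of s i j] sym[of t i j] edge_nodes[OF e] ij by simp
      qed (use * ij in simp)
    qed
  next
    assume ?R
    then show ?L using entry edge_nodes[OF e] by auto
  qed
  then show ?thesis unfolding overlap_consistent_def by (intro ball_cong refl) auto
qed

text \<open>Each entry of \<open>A p\<close> is charged to exactly one clique, the first one containing it.\<close>

lemma conv_value_eq:
  assumes p: "p \<le> m"
    and Z: "\<And>s i j. s \<in> {1..l} \<Longrightarrow> i \<in> C s \<Longrightarrow> j \<in> C s \<Longrightarrow> Y s $$ (\<sigma> s i, \<sigma> s j) = Z $$ (i, j)"
  shows "conv_value l C \<sigma> A p Y = mat_inner (A p) Z"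
proof -
  define S where "S = (\<lambda>i j. {t \<in> {1..l}. i \<in> C t \<and> j \<in> C t})"
  \<comment> \<open>The membership conjunct makes \<open>f\<close> vanish outside the clique, so
    that sums may run over all indices, and it guards against the minimum of an empty set.\<close>
  define f where "f = (\<lambda>s i j. if s \<in> S i j \<and> s = Min (S i j) then A p $$ (i, j) * Z $$ (i, j) else 0)"
  have "conv_value l C \<sigma> A p Y = (\<Sum>s=1..l. \<Sum>i<n. \<Sum>j<n. f s i j)"
    unfolding conv_value_def
  proof (intro sum.cong refl)
    fix s assume s: "s \<in> {1..l}"
    have "mat_inner (clique_data l C \<sigma> A s p) (Y s) = (\<Sum>i\<in>C s. \<Sum>j\<in>C s. f s i j)"
      unfolding mat_inner_clique_data[where C = C and \<sigma> = \<sigma>, OF ordering[OF s]]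
      using s by (intro sum.cong refl) (simp add: f_def S_def Z)
    also have "\<dots> = (\<Sum>i\<in>C s. \<Sum>j<n. f s i j)"
      using clique_subset[OF s] by (intro sum.cong refl sum.mono_neutral_left) (auto simp: f_def S_def)
    also have "\<dots> = (\<Sum>i<n. \<Sum>j<n. f s i j)"
      using clique_subset[OF s] by (intro sum.mono_neutral_left) (auto simp: f_def S_def)
    finally show "mat_inner (clique_data l C \<sigma> A s p) (Y s) = (\<Sum>i<n. \<Sum>j<n. f s i j)" .
  qed
  also have "\<dots> = (\<Sum>i<n. \<Sum>s=1..l. \<Sum>j<n. f s i j)" by (rule sum.swap)
  also have "\<dots> = (\<Sum>i<n. \<Sum>j<n. \<Sum>s=1..l. f s i j)"
    by (rule sum.cong[OF refl]) (rule sum.swap)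
  also have "\<dots> = (\<Sum>i<n. \<Sum>j<n. A p $$ (i, j) * Z $$ (i, j))"
  proof (intro sum.cong refl)
    fix i j assume ij: "i \<in> {..<n}" "j \<in> {..<n}"
    show "(\<Sum>s=1..l. f s i j) = A p $$ (i, j) * Z $$ (i, j)"
    proof (cases "S i j = {}")
      case True
      \<comment> \<open>A pair inside no clique contributes nothing on either side, since the data
        vanish there.\<close>
      then have "A p $$ (i, j) = 0" using cover[OF p, of i j] ij unfolding S_def lessThan_iff by blast
      then show ?thesis using True by (simp add: f_def)
    next
      case False
      have M: "Min (S i j) \<in> S i j" using False by (intro Min_in) (auto simp: S_def)
      then have "Min (S i j) \<in> {1..l}" by (simp add: S_def)
      moreover have "f s i j = (if s = Min (S i j) then A p $$ (i, j) * Z $$ (i, j) else 0)" for s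
        using M by (auto simp: f_def)
      ultimately show ?thesis by simp
    qed
  qed
  also have "\<dots> = mat_inner (A p) Z" using data[OF p] by (simp add: mat_inner_def)
  finally show ?thesis .
qed

section \<open>Passing between feasible points of the two programs\<close>

lemma clique_submatrix_index:
  assumes "s \<in> {1..l}" "i \<in> C s" "j \<in> C s"
  shows "clique_submatrix C \<sigma> X s $$ (\<sigma> s i, \<sigma> s j) = X $$ (i, j)"
proof -
  have "clique_index C \<sigma> s (\<sigma> s i) = i" if "i \<in> C s" for i
    using ordering[OF assms(1)] that by (auto simp: clique_index_def bij_betw_def)
  then show ?thesis using assms \<sigma>_less by (simp add: clique_submatrix_def)
qed

text \<open>Principal submatrices inherit positive semidefiniteness, and overlapping blocks read the
  same entries of \<open>X\<close>.\<close>

lemma conv_feasible_submatrices: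
  assumes X: "sdp_feasible n m A b X"
  shows "conv_feasible l C \<E> \<sigma> m A b (\<lambda>s\<in>{1..l}. clique_submatrix C \<sigma> X s)"
    (is "conv_feasible _ _ _ _ _ _ _ ?X")
proof -
  have Xc: "X \<in> carrier_mat n n" and "psd n X" using X by (auto simp: sdp_feasible_def sym_mats_def)
  then have ker: "psd_kernel {..<n} (\<lambda>i j. X $$ (i, j))"
    using psd_iff_kernel[of id "{..<n}" n X] by simp
  have idx: "?X s $$ (\<sigma> s i, \<sigma> s j) = X $$ (i, j)" if "s \<in> {1..l}" "i \<in> C s" "j \<in> C s" for s i j
    using clique_submatrix_index[OF that] that(1) by simp
  have psd: "psd (card (C s)) (?X s)" if s: "s \<in> {1..l}" for s
  proof -
    have "psd_kernel (C s) (\<lambda>i j. X $$ (i, j))"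
      using psd_kernel_subset[OF ker _ clique_subset[OF s]] by simp
    also have "?this \<longleftrightarrow> psd_kernel (C s) (\<lambda>i j. ?X s $$ (\<sigma> s i, \<sigma> s j))"
      by (intro psd_kernel_cong) (rule idx[OF s, symmetric])
    finally have "psd_kernel (C s) (\<lambda>i j. ?X s $$ (\<sigma> s i, \<sigma> s j))" .
    moreover have "?X s \<in> carrier_mat (card (C s)) (card (C s))"
      using s by (simp add: clique_submatrix_def)
    ultimately show ?thesis using psd_iff_kernel[OF ordering[OF s]] by blast
  qed
  have block: "?X \<in> block_space l C"
    unfolding block_space_def using psd by (intro restrict_PiE_iff[THEN iffD2] ballI) (auto simp: psd_def)
  have "overlap_consistent C \<E> \<sigma> ?X"
    unfolding overlap_consistent_iff[OF block]
  proof clarify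
    fix s t i j assume a: "(s, t) \<in> \<E>" "i \<in> C s" "i \<in> C t" "j \<in> C s" "j \<in> C t"
    then show "?X s $$ (\<sigma> s i, \<sigma> s j) = ?X t $$ (\<sigma> t i, \<sigma> t j)"
      using edge_nodes[OF a(1)] idx[of s i j] idx[of t i j] by metis
  qed
  moreover have "conv_value l C \<sigma> A p ?X = b p" if "p \<in> {1..m}" for p
    using conv_value_eq[of p ?X X] idx X that by (simp add: sdp_feasible_def)
  ultimately show ?thesis using block psd by (simp add: conv_feasible_def)
qed

text \<open>The equality of values includes \<open>p = 0\<close>, so the completion preserves the
  objective along with the constraints.\<close>

lemma conv_feasible_completion:
  assumes Y: "conv_feasible l C \<E> \<sigma> m A b Y"
  obtains Z where "sdp_feasible n m A b Z" "\<And>p. p \<le> m \<Longrightarrow> conv_value l C \<sigma> A p Y = mat_inner (A p) Z"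
proof -
  have block: "Y \<in> block_space l C" and cons: "overlap_consistent C \<E> \<sigma> Y"
    and psd: "\<And>s. s \<in> {1..l} \<Longrightarrow> psd (card (C s)) (Y s)"
    using Y by (auto simp: conv_feasible_def)
  have ker: "psd_kernel (C s) (\<lambda>i j. Y s $$ (\<sigma> s i, \<sigma> s j))" if s: "s \<in> {1..l}" for s
    using psd_iff_kernel[OF ordering[OF s], of "Y s"] psd[OF s] by (auto simp: psd_def sym_mats_def)
  have eqs: "Y s $$ (\<sigma> s i, \<sigma> s j) = Y t $$ (\<sigma> t i, \<sigma> t j)"
    if "(s, t) \<in> \<E>" "i \<in> C s \<inter> C t" "j \<in> C s \<inter> C t" for s t i j
    using cons that unfolding overlap_consistent_iff[OF block] by blast
  obtain W where W: "psd_kernel {..<n} W"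
    "\<And>s i j. s \<in> {1..l} \<Longrightarrow> i \<in> C s \<Longrightarrow> j \<in> C s \<Longrightarrow> W i j = Y s $$ (\<sigma> s i, \<sigma> s j)"
    using clique_tree_completion[OF clique_tree finite_clique ker eqs] unfolding union by blast
  define Z where "Z = mat n n (\<lambda>(i, j). W i j)"
  have "psd_kernel {..<n} (\<lambda>i j. Z $$ (id i, id j))"
    using W(1) psd_kernel_cong[of "{..<n}" W "\<lambda>i j. Z $$ (i, j)"] by (simp add: Z_def)
  then have "psd n Z" using psd_iff_kernel[of id "{..<n}" n Z] by (simp add: Z_def)
  have "Y s $$ (\<sigma> s i, \<sigma> s j) = Z $$ (i, j)" if "s \<in> {1..l}" "i \<in> C s" "j \<in> C s" for s i j
  proof -
    have "i < n" "j < n" using clique_subset[OF that(1)] that(2,3) by auto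
    then show ?thesis using W(2)[OF that] by (simp add: Z_def)
  qed
  then have val: "conv_value l C \<sigma> A p Y = mat_inner (A p) Z" if "p \<le> m" for p
    using conv_value_eq[OF that] by blast
  have "sdp_feasible n m A b Z"
    using \<open>psd n Z\<close> val Y by (auto simp: sdp_feasible_def psd_def conv_feasible_def)
  then show ?thesis using val that by blast
qed

lemma conv_optimal_submatrices:
  assumes X: "sdp_optimal n m A b X"
  shows "conv_optimal l C \<E> \<sigma> m A b (\<lambda>s\<in>{1..l}. clique_submatrix C \<sigma> X s)"
    (is "conv_optimal _ _ _ _ _ _ _ ?X")
  unfolding conv_optimal_def
proof (intro conjI allI impI)
  show "conv_feasible l C \<E> \<sigma> m A b ?X"
    using X by (intro conv_feasible_submatrices) (simp add: sdp_optimal_def)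
  fix Y assume "conv_feasible l C \<E> \<sigma> m A b Y"
  then obtain Z where Z: "sdp_feasible n m A b Z"
    "\<And>p. p \<le> m \<Longrightarrow> conv_value l C \<sigma> A p Y = mat_inner (A p) Z"
    using conv_feasible_completion by metis
  have "conv_value l C \<sigma> A 0 ?X = mat_inner (A 0) X"
    by (rule conv_value_eq) (simp_all add: clique_submatrix_index)
  also have "\<dots> \<le> mat_inner (A 0) Z" using X Z(1) by (simp add: sdp_optimal_def)
  finally show "conv_value l C \<sigma> A 0 ?X \<le> conv_value l C \<sigma> A 0 Y" using Z(2) by simp
qed

section \<open>Degeneracy at an overlap larger than the rank\<close>

lemma not_primal_nondegenerate:
  assumes X: "X \<in> carrier_mat n n" and e: "(s, t) \<in> \<E>" and r: "mat_rank n X < card (C s \<inter> C t)"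
  shows "\<not> primal_nondegenerate l C \<E> \<sigma> m A (\<lambda>s\<in>{1..l}. clique_submatrix C \<sigma> X s)"
    (is "\<not> primal_nondegenerate _ _ _ _ _ _ ?X")
proof
  assume "primal_nondegenerate l C \<E> \<sigma> m A ?X"
  then obtain Q ev where ed: "\<And>s. s \<in> {1..l} \<Longrightarrow> eigen_decomposition (card (C s)) (?X s) (Q s) (ev s)"
    and full: "{\<lambda>s\<in>{1..l}. Y s + Z s | Y Z. Y \<in> tangent_product l C ?X Q \<and> Z \<in> null_space l C \<E> \<sigma> m A}
      = block_space l C"
    unfolding primal_nondegenerate_def by blast
  have st: "s \<in> {1..l}" "t \<in> {1..l}" "s \<noteq> t" using edge_nodes[OF e] by auto
  obtain z where z0: "\<And>j. j \<notin> C s \<inter> C t \<Longrightarrow> z j = 0" and z1: "\<exists>j\<in>C s \<inter> C t. z j \<noteq> (0::real)"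
    and z: "\<And>i. i < n \<Longrightarrow> (\<Sum>j\<in>C s \<inter> C t. X $$ (i, j) * z j) = 0"
    using low_rank_kernel_vector[OF X _ r] clique_subset[OF st(1)] by blast
  \<comment> \<open>The part of \<open>z\<close> on \<open>C q\<close>, listed in the order given by
    \<open>\<sigma> q\<close>.\<close>
  define w where "w = (\<lambda>q. vec (card (C q)) (\<lambda>a. z (clique_index C \<sigma> q a)))"
  have w: "w q \<in> carrier_vec (card (C q))" for q by (simp add: w_def)
  have wz: "w q $ \<sigma> q i = z i" if "q \<in> {1..l}" "i \<in> C q" for q i
    using ordering[OF that(1)] \<sigma>_less[OF that] that(2)
    by (auto simp: w_def clique_index_def bij_betw_def)
  define \<phi> where "\<phi> = (\<lambda>q M. w q \<bullet> (M *\<^sub>v w q))"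
  \<comment> \<open>As \<open>z\<close> is supported on the overlap, the value depends only on the
    entries there, which are the ones that consistency equates.\<close>
  have \<phi>: "\<phi> q M = bform (C s \<inter> C t) (\<lambda>i j. M $$ (\<sigma> q i, \<sigma> q j)) z z"
    if q: "q \<in> {s, t}" and M: "M \<in> carrier_mat (card (C q)) (card (C q))" for q M
  proof -
    have ql: "q \<in> {1..l}" using q st by auto
    have "\<phi> q M = bform (C q) (\<lambda>i j. M $$ (\<sigma> q i, \<sigma> q j)) (\<lambda>i. w q $ \<sigma> q i) (\<lambda>i. w q $ \<sigma> q i)"
      unfolding \<phi>_def by (rule bform_reindex[OF ordering[OF ql] M w, symmetric])
    also have "\<dots> = bform (C q) (\<lambda>i j. M $$ (\<sigma> q i, \<sigma> q j)) z z"
      by (intro bform_cong) (simp add: wz[OF ql])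
    also have "\<dots> = bform (C s \<inter> C t) (\<lambda>i j. M $$ (\<sigma> q i, \<sigma> q j)) z z"
      using q z0 by (intro bform_mono_support finite_clique[OF ql]) auto
    finally show ?thesis .
  qed
  \<comment> \<open>Rows of the submatrix act on \<open>w q\<close> as rows of \<open>X\<close> act
    on \<open>z\<close>, because \<open>C q\<close> contains the support of
    \<open>z\<close>.\<close>
  have kernel: "?X q *\<^sub>v w q = 0\<^sub>v (card (C q))" if q: "q \<in> {s, t}" for q
  proof (rule eq_vecI)
    have ql: "q \<in> {1..l}" using q st by auto
    show "dim_vec (?X q *\<^sub>v w q) = dim_vec (0\<^sub>v (card (C q)))"
      using ql by (simp add: clique_submatrix_def)
    fix a assume "a < dim_vec (0\<^sub>v (card (C q)) :: real vec)"
    then have a: "a < card (C q)" by simp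
    then obtain i where i: "i \<in> C q" "a = \<sigma> q i"
      using ordering[OF ql] unfolding bij_betw_def by (metis imageE lessThan_iff)
    have "(?X q *\<^sub>v w q) $ a = (\<Sum>b<card (C q). ?X q $$ (a, b) * w q $ b)"
      using ql a w[of q] by (simp add: clique_submatrix_def scalar_prod_def atLeast0LessThan)
    also have "\<dots> = (\<Sum>j\<in>C q. ?X q $$ (a, \<sigma> q j) * w q $ \<sigma> q j)"
      by (rule sum.reindex_bij_betw[OF ordering[OF ql], symmetric])
    also have "\<dots> = (\<Sum>j\<in>C q. X $$ (i, j) * z j)"
      using ql i by (intro sum.cong refl) (simp add: wz clique_submatrix_index)
    also have "\<dots> = (\<Sum>j\<in>C s \<inter> C t. X $$ (i, j) * z j)"
      using q z0 finite_clique[OF ql] by (intro sum.mono_neutral_right) auto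
    also have "\<dots> = 0" using z clique_subset[OF ql] i by auto
    finally show "(?X q *\<^sub>v w q) $ a = 0\<^sub>v (card (C q)) $ a" using a by simp
  qed
  \<comment> \<open>A tuple on which the two values differ: the identity in block \<open>s\<close>
    gives the squared length of \<open>w s\<close>, the zero matrix in block \<open>t\<close> gives
    0.\<close>
  define B where "B = (\<lambda>q\<in>{1..l}. if q = s then 1\<^sub>m (card (C q)) else 0\<^sub>m (card (C q)) (card (C q)) :: real mat)"
  have "B \<in> block_space l C"
    unfolding block_space_def B_def by (intro restrict_PiE_iff[THEN iffD2] ballI) (auto simp: sym_mats_iff)
  then obtain Y Z where YZ: "B = (\<lambda>q\<in>{1..l}. Y q + Z q)" "Y \<in> tangent_product l C ?X Q"
    "Z \<in> null_space l C \<E> \<sigma> m A"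
    unfolding full[symmetric] by blast
  have Zb: "Z \<in> block_space l C" and Zc: "overlap_consistent C \<E> \<sigma> Z"
    using YZ(3) by (auto simp: null_space_def)
  have Zcar: "Z q \<in> carrier_mat (card (C q)) (card (C q))" if "q \<in> {1..l}" for q
    using block_sym[OF Zb that] by (simp add: sym_mats_def)
  \<comment> \<open>The tangent component contributes nothing to \<open>\<phi>\<close>, so only the
    null-space component remains.\<close>
  have \<phi>B: "\<phi> q (B q) = \<phi> q (Z q)" if q: "q \<in> {s, t}" for q
  proof -
    have ql: "q \<in> {1..l}" using q st by auto
    have Yt: "Y q \<in> tangent_space (card (C q)) (mat_rank (card (C q)) (?X q)) (Q q)"
      using YZ(2) ql unfolding tangent_product_def by (rule PiE_mem)
    have Qc: "Q q \<in> carrier_mat (card (C q)) (card (C q))"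
      using ed[OF ql] by (simp add: eigen_decomposition_def)
    have "Y q \<in> carrier_mat (card (C q)) (card (C q))"
      using Yt Qc by (auto simp: tangent_space_def)
    then have "\<phi> q (B q) = \<phi> q (Y q) + \<phi> q (Z q)"
      using Zcar[OF ql] w[of q] ql
      by (simp add: YZ(1) \<phi>_def add_mult_distrib_mat_vec[of _ "card (C q)" "card (C q)"]
          scalar_prod_add_distrib[of _ "card (C q)"])
    moreover have "\<phi> q (Y q) = 0"
      unfolding \<phi>_def by (rule tangent_space_isotropic[OF ed[OF ql] w kernel[OF q] Yt])
    ultimately show ?thesis by simp
  qed
  have "\<phi> s (Z s) = \<phi> t (Z t)"
  proof -
    have "Z s $$ (\<sigma> s i, \<sigma> s j) = Z t $$ (\<sigma> t i, \<sigma> t j)" if "i \<in> C s \<inter> C t" "j \<in> C s \<inter> C t" for i j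
      using Zc e that unfolding overlap_consistent_iff[OF Zb] by blast
    then show ?thesis using \<phi> Zcar st by (auto intro!: bform_cong)
  qed
  then have "\<phi> s (B s) = \<phi> t (B t)" using \<phi>B by simp
  moreover have "\<phi> t (B t) = 0" using st w[of t] by (simp add: \<phi>_def B_def scalar_prod_def)
  ultimately have "w s \<bullet> w s = 0" using st w[of s] by (simp add: \<phi>_def B_def)
  then have "(\<Sum>a<card (C s). (w s $ a)\<^sup>2) = 0"
    using w[of s] by (simp add: scalar_prod_def power2_eq_square atLeast0LessThan)
  then have "w s $ a = 0" if "a < card (C s)" for a
    using that by (simp add: sum_nonneg_eq_0_iff)
  then have "z j = 0" if "j \<in> C s" for j
    using wz[OF st(1) that] \<sigma>_less[OF st(1) that] by simp
  then show False using z1 by blast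
qed

end

theorem theorem1:
  fixes n m l :: nat
    and A :: "nat \<Rightarrow> real mat" and b :: "nat \<Rightarrow> real"
    and F :: "(nat \<times> nat) set"
    and C :: "nat \<Rightarrow> nat set" and \<E> :: "(nat \<times> nat) set"
    and \<sigma> :: "nat \<Rightarrow> nat \<Rightarrow> nat"
    and X :: "real mat"
  assumes data: "\<forall>p\<le>m. A p \<in> sym_mats n"
    and extension: "aggregate_sparsity n m A \<subseteq> F"
    and chordal: "chordal {..<n} F"
    and cliques: "bij_betw C {1..l} {K. maximal_clique {..<n} F K}"
    and clique_tree: "clique_tree l C \<E>"
    and ordering: "\<forall>s\<in>{1..l}. bij_betw (\<sigma> s) (C s) {..<card (C s)}"
    and optimal: "sdp_optimal n m A b X"
    and low_rank: "\<exists>(s, t)\<in>\<E>. mat_rank n X < card (C s \<inter> C t)"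
  shows "conv_optimal l C \<E> \<sigma> m A b (\<lambda>s\<in>{1..l}. clique_submatrix C \<sigma> X s)
    \<and> primal_degenerate l C \<E> \<sigma> m A b (\<lambda>s\<in>{1..l}. clique_submatrix C \<sigma> X s)"
proof -
  have finV: "finite {..<n}" by simp
  have C: "maximal_clique {..<n} F (C s)" if "s \<in> {1..l}" for s
    using cliques that by (auto simp: bij_betw_def)
  have max_clique: "\<exists>s\<in>{1..l}. K \<subseteq> C s" if K: "clique {..<n} F K" for K
  proof -
    obtain M where M: "maximal_clique {..<n} F M" "K \<subseteq> M"
      by (rule clique_in_maximal_clique[OF finV K])
    then have "M \<in> C ` {1..l}" using cliques by (simp add: bij_betw_def)
    then show ?thesis using M(2) by blast
  qed
  have symF: "sym F" using chordal by (simp add: chordal_def graph_on_def)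
  interpret conversion n m l A C \<E> \<sigma>
  proof
    show "A p \<in> carrier_mat n n" if "p \<le> m" for p
      using data that by (simp add: sym_mats_def)
    show "\<exists>s\<in>{1..l}. i \<in> C s \<and> j \<in> C s"
      if "p \<le> m" "i < n" "j < n" "A p $$ (i, j) \<noteq> 0" for p i j
    proof -
      \<comment> \<open>A nonzero off-diagonal entry gives an edge and hence a two-element clique; a
        diagonal entry gives a singleton.\<close>
      have "i \<noteq> j \<Longrightarrow> (i, j) \<in> F"
        using extension that unfolding aggregate_sparsity_def by blast
      then have "clique {..<n} F {i, j}" using that symD[OF symF] by (auto simp: clique_def)
      from max_clique[OF this] show ?thesis by auto
    qed
    show "(\<Union>s\<in>{1..l}. C s) = {..<n}"
    proof
      show "(\<Union>s\<in>{1..l}. C s) \<subseteq> {..<n}"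
        using C unfolding maximal_clique_def clique_def by blast
      show "{..<n} \<subseteq> (\<Union>s\<in>{1..l}. C s)"
      proof
        fix i assume "i \<in> {..<n}"
        \<comment> \<open>Singletons are cliques, so isolated vertices are covered as well.\<close>
        then have "clique {..<n} F {i}" by (simp add: clique_def)
        from max_clique[OF this] show "i \<in> (\<Union>s\<in>{1..l}. C s)" by auto
      qed
    qed
    show "clique_tree l C \<E>" by (rule clique_tree)
    show "bij_betw (\<sigma> s) (C s) {..<card (C s)}" if "s \<in> {1..l}" for s
      using ordering that by blast
  qed
  have feasible: "sdp_feasible n m A b X" using optimal by (simp add: sdp_optimal_def)
  obtain s t where "(s, t) \<in> \<E>" "mat_rank n X < card (C s \<inter> C t)" using low_rank by blast
  moreover have "X \<in> carrier_mat n n" using feasible by (simp add: sdp_feasible_def sym_mats_def)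
  ultimately show ?thesis
    using conv_optimal_submatrices[OF optimal] conv_feasible_submatrices[OF feasible]
      not_primal_nondegenerate
    by (simp add: primal_degenerate_def)
qed

end
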